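(* If $G$ is a nice graph, then $G$ is $(1, \partial_2(G) + 1)$-weight choosable.
   Context: All graphs are finite, simple and loopless. A graph is nice if it has no connected component isomorphic to $K_2$. A graph $G$ is $(k,l)$-weight choosable if for every assignment of a list $L_v$ of $k$ real numbers to each vertex $v$ and a list $L_e$ of $l$ real numbers to each edge $e$, there is a choice of weights $w(v)\in L_v$ and $w(e)\in L_e$ (for all $v \in V(G)$, $e\in E(G)$) such that the function $v\mapsto w(v)+\sum_{e\ni v} w(e)$ is a proper colouring of $V(G)$ (adjacent vertices get different values). For a graph $H$ having two vertices at distance exactly $2$ in $H$, let $\delta_2(H)$ be the minimum of $d_H(u)+d_H(v)$ over all pairs $u,v\in V(H)$ at distance exactly $2$ in $H$. Then $\partial_2(G) = \max \delta_2(H)$, the maximum taken over all induced subgraphs $H$ of $G$ that have two vertices at distance exactly $2$. If no induced subgraph of $G$ has two vertices at distance exactly $2$, then by convention $\partial_2(G) = 2\Delta(G)$, where $\Delta(G)$ is the maximum degree of $G$. *)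

theory Defs
  imports Complex_Main "HOL-Library.Extended_Nat"
begin

record 'a ugraph =
  verts :: "'a set"
  edges :: "'a set set"

definition simple_graph :: "'a ugraph \<Rightarrow> bool" where
  "simple_graph G \<longleftrightarrow> finite (verts G) \<and> (\<forall>e \<in> edges G. e \<subseteq> verts G \<and> card e = 2)"

definition induced_subgraph :: "'a ugraph \<Rightarrow> 'a set \<Rightarrow> 'a ugraph" where
  "induced_subgraph G S = \<lparr>verts = S, edges = {e \<in> edges G. e \<subseteq> S}\<rparr>"

definition vdegree :: "'a ugraph \<Rightarrow> 'a \<Rightarrow> nat" where
  "vdegree G v = card {e \<in> edges G. v \<in> e}"

text \<open>The inserted 0 only matters for the graph without vertices, whose maximum degree is set to 0.\<close>

definition max_degree :: "'a ugraph \<Rightarrow> nat" where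
  "max_degree G = Max (insert 0 (vdegree G ` verts G))"

definition walks :: "'a ugraph \<Rightarrow> 'a \<Rightarrow> 'a \<Rightarrow> 'a list set" where
  "walks G u v =
     {p. p \<noteq> [] \<and> set p \<subseteq> verts G \<and> successively (\<lambda>x y. {x, y} \<in> edges G) p
         \<and> hd p = u \<and> last p = v}"

text \<open>A walk is given by its vertices, so its length is one less than that of the list.
  The distance is infinite when there is no walk.\<close>

definition gdist :: "'a ugraph \<Rightarrow> 'a \<Rightarrow> 'a \<Rightarrow> enat" where
  "gdist G u v = (INF p \<in> walks G u v. enat (length p - 1))"

definition components :: "'a ugraph \<Rightarrow> 'a ugraph set" where
  "components G = (\<lambda>v. induced_subgraph G {u. walks G v u \<noteq> {}}) ` verts G"

definition graph_isomorphic :: "'a ugraph \<Rightarrow> 'b ugraph \<Rightarrow> bool" where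
  "graph_isomorphic G H \<longleftrightarrow>
     (\<exists>f. bij_betw f (verts G) (verts H) \<and>
          (\<forall>u \<in> verts G. \<forall>v \<in> verts G. {u, v} \<in> edges G \<longleftrightarrow> {f u, f v} \<in> edges H))"

definition complete_graph :: "nat \<Rightarrow> nat ugraph" where
  "complete_graph n = \<lparr>verts = {..<n}, edges = {e. e \<subseteq> {..<n} \<and> card e = 2}\<rparr>"

definition nice :: "'a ugraph \<Rightarrow> bool" where
  "nice G \<longleftrightarrow> (\<forall>C \<in> components G. \<not> graph_isomorphic C (complete_graph 2))"

text \<open>A list of \<open>k\<close> real numbers is a set of \<open>k\<close> distinct reals, as usual in list colouring.\<close>

definition weight_choosable :: "'a ugraph \<Rightarrow> nat \<Rightarrow> nat \<Rightarrow> bool" where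
  "weight_choosable G k l \<longleftrightarrow>
     (\<forall>(Lv :: 'a \<Rightarrow> real set) (Le :: 'a set \<Rightarrow> real set).
        (\<forall>v \<in> verts G. finite (Lv v) \<and> card (Lv v) = k) \<and>
        (\<forall>e \<in> edges G. finite (Le e) \<and> card (Le e) = l) \<longrightarrow>
        (\<exists>(wv :: 'a \<Rightarrow> real) (we :: 'a set \<Rightarrow> real).
           (\<forall>v \<in> verts G. wv v \<in> Lv v) \<and>
           (\<forall>e \<in> edges G. we e \<in> Le e) \<and>
           (\<forall>u \<in> verts G. \<forall>v \<in> verts G. {u, v} \<in> edges G \<longrightarrow>
              wv u + (\<Sum>e | e \<in> edges G \<and> u \<in> e. we e)
                \<noteq> wv v + (\<Sum>e | e \<in> edges G \<and> v \<in> e. we e))))"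

definition dist2_pairs :: "'a ugraph \<Rightarrow> ('a \<times> 'a) set" where
  "dist2_pairs H = {(u, v). u \<in> verts H \<and> v \<in> verts H \<and> gdist H u v = 2}"

definition delta2 :: "'a ugraph \<Rightarrow> nat" where
  "delta2 H = Min ((\<lambda>(u, v). vdegree H u + vdegree H v) ` dist2_pairs H)"

definition dist2_subgraphs :: "'a ugraph \<Rightarrow> 'a ugraph set" where
  "dist2_subgraphs G = {H \<in> induced_subgraph G ` Pow (verts G). dist2_pairs H \<noteq> {}}"

definition partial2 :: "'a ugraph \<Rightarrow> nat" where
  "partial2 G =
     (if dist2_subgraphs G = {} then 2 * max_degree G
      else Max (delta2 ` dist2_subgraphs G))"

end

theory Submission
  imports Defs "HOL-Combinatorics.Permutations"
begin

text \<open>Let \<open>s\<close> be the bound on the degree sums. The colour differences along the edges are affine forms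
  in the edge weights, and by the argument of the Combinatorial Nullstellensatz they can all be made
  nonzero, with weights from lists of size \<open>s + 1\<close>, as soon as one can assign to every edge \<open>j\<close> a
  direction \<open>d j\<close> in weight space such that the permanent of the matrix of effects of the directions on
  the colour differences is nonzero and every edge weight occurs in at most \<open>s\<close> directions.

  The directions are found by removing two vertices at a time. If \<open>u\<close>, \<open>v\<close> are at distance 2 with
  common neighbour \<open>w\<close>, then moving weight from \<open>vw\<close> to \<open>uw\<close> affects exactly the edges at \<open>u\<close> or \<open>v\<close>;
  using this direction once for each of them splits off a block of the permanent. If there is no such
  pair, all components are cliques; from a clique with at least three vertices one removes two vertices
  \<open>x\<close>, \<open>y\<close>, using the directions \<open>xw - yw\<close> at most twice for every other vertex \<open>w\<close>, and \<open>xy\<close> twice.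
  Components \<open>K\<^sub>2\<close> created by a removal need one more direction each: the weight of an edge joining them
  to a removed vertex.\<close>

section \<open>Permanents\<close>

definition permanent :: "'r set \<Rightarrow> ('r \<Rightarrow> 'r \<Rightarrow> real) \<Rightarrow> real" where
  "permanent R B = (\<Sum>\<sigma> | \<sigma> permutes R. \<Prod>i\<in>R. B i (\<sigma> i))"

lemma permanent_empty [simp]: "permanent {} B = 1"
  by (simp add: permanent_def)

lemma permanent_cong:
  assumes "\<And>i j. i \<in> R \<Longrightarrow> j \<in> R \<Longrightarrow> B i j = B' i j"
  shows "permanent R B = permanent R B'"
  unfolding permanent_def
  by (intro sum.cong prod.cong refl assms) (auto simp: permutes_in_image)

text \<open>This is the matrix in which every column carries the same direction. A determinant would
  vanish here, but the permanent is nonzero whenever no \<open>b i\<close> is.\<close>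

lemma permanent_const:
  assumes "finite R" and "\<And>i j. i \<in> R \<Longrightarrow> j \<in> R \<Longrightarrow> B i j = b i"
  shows "permanent R B = fact (card R) * (\<Prod>i\<in>R. b i)"
proof -
  have "permanent R B = permanent R (\<lambda>i j. b i)"
    by (rule permanent_cong) (simp add: assms)
  then show ?thesis
    by (simp add: permanent_def card_permutations assms(1))
qed

text \<open>A permutation sending a row of \<open>R2\<close> to a column of \<open>R1\<close> meets
  a zero entry. The others preserve \<open>R2\<close>, hence by finiteness also \<open>R1\<close>,
  so they are pairs of permutations of the blocks.\<close>

lemma permanent_block:
  assumes fin: "finite R1" "finite R2" and disj: "R1 \<inter> R2 = {}"
    and zero: "\<And>i j. i \<in> R2 \<Longrightarrow> j \<in> R1 \<Longrightarrow> B i j = 0"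
  shows "permanent (R1 \<union> R2) B = permanent R1 B * permanent R2 B"
proof -
  define m where "m = (\<lambda>(p :: 'a \<Rightarrow> 'a, q :: 'a \<Rightarrow> 'a). \<lambda>i. if i \<in> R1 then p i else q i)"
  define P where "P = {p. p permutes R1} \<times> {q. q permutes R2}"
  have m_perm: "m (p, q) permutes R1 \<union> R2" if "p permutes R1" "q permutes R2" for p q
  proof -
    have "m (p, q) = p \<circ> q"
      using that disj unfolding m_def
      by (auto simp: fun_eq_iff permutes_in_image permutes_not_in disjoint_iff)
        (metis permutes_in_image permutes_not_in)+
    then show ?thesis
      using that by (simp add: permutes_compose permutes_subset)
  qed
  have inj: "inj_on m P"
  proof (rule inj_onI, clarify)
    fix p q p' q' assume "(p, q) \<in> P" "(p', q') \<in> P" and eq: "m (p, q) = m (p', q')"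
    then have *: "p permutes R1" "q permutes R2" "p' permutes R1" "q' permutes R2"
      by (auto simp: P_def)
    have "p i = p' i" for i
      using fun_cong[OF eq, of i] * by (cases "i \<in> R1") (auto simp: m_def permutes_not_in)
    moreover have "q i = q' i" for i
      using fun_cong[OF eq, of i] * disj
      by (cases "i \<in> R2") (auto simp: m_def permutes_not_in split: if_splits)
    ultimately show "p = p' \<and> q = q'" by auto
  qed
  have surj: "\<sigma> \<in> m ` P" if \<sigma>: "\<sigma> permutes R1 \<union> R2" and sub: "\<sigma> ` R2 \<subseteq> R2" for \<sigma>
  proof -
    have inj\<sigma>: "inj \<sigma>" using \<sigma> by (rule permutes_inj)
    have im2: "\<sigma> ` R2 = R2"
      using sub fin(2) inj\<sigma> by (metis card_image card_subset_eq inj_on_subset subset_UNIV)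
    have im1: "\<sigma> ` R1 = R1"
    proof -
      have "R1 = (R1 \<union> R2) - R2" using disj by auto
      moreover have "\<sigma> ` ((R1 \<union> R2) - R2) = \<sigma> ` (R1 \<union> R2) - \<sigma> ` R2"
        using inj\<sigma> by (simp add: image_set_diff)
      ultimately show ?thesis using permutes_image[OF \<sigma>] im2 by metis
    qed
    define p where "p = (\<lambda>i. if i \<in> R1 then \<sigma> i else i)"
    define q where "q = (\<lambda>i. if i \<in> R2 then \<sigma> i else i)"
    have "p permutes R1"
      by (rule bij_imp_permutes) (use im1 inj\<sigma> in \<open>auto simp: p_def bij_betw_def inj_on_def\<close>)
    moreover have "q permutes R2"
      by (rule bij_imp_permutes) (use im2 inj\<sigma> in \<open>auto simp: q_def bij_betw_def inj_on_def\<close>)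
    moreover have "\<sigma> = m (p, q)"
      using \<sigma> by (auto simp: m_def p_def q_def fun_eq_iff permutes_not_in)
    ultimately show ?thesis by (auto simp: P_def)
  qed
  have "permanent R1 B * permanent R2 B =
      (\<Sum>(p, q)\<in>P. (\<Prod>i\<in>R1. B i (p i)) * (\<Prod>i\<in>R2. B i (q i)))"
    by (simp add: permanent_def sum_product sum.cartesian_product P_def)
  also have "\<dots> = (\<Sum>x\<in>P. \<Prod>i\<in>R1 \<union> R2. B i (m x i))"
  proof (intro sum.cong refl, clarify)
    fix p q
    have "(\<Prod>i\<in>R1. B i (p i)) = (\<Prod>i\<in>R1. B i (m (p, q) i))"
      by (intro prod.cong) (auto simp: m_def)
    moreover have "(\<Prod>i\<in>R2. B i (q i)) = (\<Prod>i\<in>R2. B i (m (p, q) i))"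
      using disj by (intro prod.cong) (auto simp: m_def)
    ultimately show "(\<Prod>i\<in>R1. B i (p i)) * (\<Prod>i\<in>R2. B i (q i)) = (\<Prod>i\<in>R1 \<union> R2. B i (m (p, q) i))"
      using fin disj by (simp add: prod.union_disjoint)
  qed
  also have "\<dots> = (\<Sum>\<sigma>\<in>m ` P. \<Prod>i\<in>R1 \<union> R2. B i (\<sigma> i))"
    by (simp add: sum.reindex[OF inj])
  also have "\<dots> = (\<Sum>\<sigma> | \<sigma> permutes R1 \<union> R2. \<Prod>i\<in>R1 \<union> R2. B i (\<sigma> i))"
  proof (rule sum.mono_neutral_left)
    show "finite {\<sigma>. \<sigma> permutes R1 \<union> R2}"
      using fin by (simp add: finite_permutations)
    show "m ` P \<subseteq> {\<sigma>. \<sigma> permutes R1 \<union> R2}"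
      using m_perm by (auto simp: P_def)
    show "\<forall>\<sigma>\<in>{\<sigma>. \<sigma> permutes R1 \<union> R2} - m ` P. (\<Prod>i\<in>R1 \<union> R2. B i (\<sigma> i)) = 0"
    proof
      fix \<sigma> assume "\<sigma> \<in> {\<sigma>. \<sigma> permutes R1 \<union> R2} - m ` P"
      then have \<sigma>: "\<sigma> permutes R1 \<union> R2" and "\<not> \<sigma> ` R2 \<subseteq> R2"
        using surj by auto
      then obtain i where "i \<in> R2" "\<sigma> i \<notin> R2" by auto
      moreover from this have "\<sigma> i \<in> R1"
        using permutes_in_image[OF \<sigma>, of i] by auto
      ultimately show "(\<Prod>i\<in>R1 \<union> R2. B i (\<sigma> i)) = 0"
        using fin zero by (intro prod_zero) auto
    qed
  qed
  finally show ?thesis by (simp add: permanent_def)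
qed

text \<open>After dividing each row by \<open>b\<close>, the permanent is the sum of \<open>q (\<sigma> a) * q (\<sigma> c)\<close> over all
  permutations \<open>\<sigma>\<close>, with \<open>q = g / b\<close>. This value does not depend on \<open>c\<close>, and summing it over all
  \<open>c\<close> gives the negative of a sum of squares, because the entries of \<open>q\<close> add up to zero.\<close>

lemma permanent_two_columns_nonzero:
  assumes fin: "finite R" and a: "a \<in> R" and c: "c \<in> R" and ac: "a \<noteq> c"
    and b: "\<And>i. i \<in> R \<Longrightarrow> b i \<noteq> 0"
    and sum0: "(\<Sum>i\<in>R. g i / b i) = 0" and nz: "k \<in> R" "g k \<noteq> 0"
  shows "permanent R (\<lambda>i j. if j = a \<or> j = c then g i else b i) \<noteq> 0"
proof -
  define q where "q i = g i / b i" for i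
  define X where "X j = (\<Sum>\<sigma> | \<sigma> permutes R. q (\<sigma> a) * q (\<sigma> j))" for j
  have finP: "finite {\<sigma>. \<sigma> permutes R}" using fin by (simp add: finite_permutations)
  \<comment> \<open>Composing with the transposition of \<open>j\<close> and \<open>c\<close>
    permutes the summands and leaves the value at \<open>a\<close> alone, since neither
    \<open>j\<close> nor \<open>c\<close> is \<open>a\<close>.\<close>
  have X_eq: "X j = X c" if j: "j \<in> R" "j \<noteq> a" for j
  proof -
    have "transpose j c permutes R" using j c by (simp add: permutes_swap_id)
    then have "X j = (\<Sum>\<sigma> | \<sigma> permutes R. q ((\<sigma> \<circ> transpose j c) a) * q ((\<sigma> \<circ> transpose j c) j))"
      unfolding X_def by (rule sum_permutations_compose_right)
    also have "\<dots> = X c"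
      using j ac by (simp add: X_def transpose_def)
    finally show ?thesis .
  qed
  have "(\<Sum>j\<in>R - {a}. X j) = (\<Sum>\<sigma> | \<sigma> permutes R. q (\<sigma> a) * (\<Sum>j\<in>R - {a}. q (\<sigma> j)))"
    unfolding X_def by (subst sum.swap) (simp add: sum_distrib_left)
  also have "\<dots> = (\<Sum>\<sigma> | \<sigma> permutes R. - (q (\<sigma> a))\<^sup>2)"
  proof (intro sum.cong refl, clarify)
    fix \<sigma> assume \<sigma>: "\<sigma> permutes R"
    have "(\<Sum>j\<in>R. q (\<sigma> j)) = (\<Sum>j\<in>R. q j)"
      using sum.permute[OF \<sigma>, of q] by (simp add: o_def)
    then have "(\<Sum>j\<in>R - {a}. q (\<sigma> j)) = - q (\<sigma> a)"
      using fin a sum0 by (simp add: sum_diff1 q_def)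
    then show "q (\<sigma> a) * (\<Sum>j\<in>R - {a}. q (\<sigma> j)) = - (q (\<sigma> a))\<^sup>2"
      by (simp add: power2_eq_square)
  qed
  also have "\<dots> < 0"
  proof -
    have "0 < (\<Sum>\<sigma> | \<sigma> permutes R. (q (\<sigma> a))\<^sup>2)"
    proof (rule sum_pos2[OF finP])
      show "transpose a k \<in> {\<sigma>. \<sigma> permutes R}" using a nz by (simp add: permutes_swap_id)
      show "0 < (q (transpose a k a))\<^sup>2" using nz b by (simp add: q_def)
    qed simp
    then show ?thesis by (simp add: sum_negf)
  qed
  finally have "X c \<noteq> 0" using X_eq by auto
  moreover have "permanent R (\<lambda>i j. if j = a \<or> j = c then g i else b i) = (\<Prod>i\<in>R. b i) * X c"
  proof -
    have "(\<Prod>i\<in>R. if \<sigma> i = a \<or> \<sigma> i = c then g i else b i)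
        = (\<Prod>i\<in>R. b i) * (q (inv \<sigma> a) * q (inv \<sigma> c))" if \<sigma>: "\<sigma> permutes R" for \<sigma>
    proof -
      \<comment> \<open>Column \<open>a\<close> is met in row \<open>inv \<sigma> a\<close>, so
        inverses appear in the product; they disappear again on reindexing the sum by
        \<open>inv \<sigma>\<close>.\<close>
      have iff: "\<sigma> i = z \<longleftrightarrow> i = inv \<sigma> z" for i z
        using permutes_inverses[OF \<sigma>] by metis
      have in_R: "inv \<sigma> a \<in> R" "inv \<sigma> c \<in> R"
        using permutes_in_image[OF permutes_inv[OF \<sigma>]] a c by auto
      have ne: "inv \<sigma> a \<noteq> inv \<sigma> c"
        using ac permutes_inverses(1)[OF \<sigma>] by metis
      have "(\<Prod>i\<in>R. if \<sigma> i = a \<or> \<sigma> i = c then g i else b i)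
          = (\<Prod>i\<in>R. b i * (if i = inv \<sigma> a \<or> i = inv \<sigma> c then q i else 1))"
        by (intro prod.cong) (use b iff in \<open>auto simp: q_def\<close>)
      also have "\<dots> = (\<Prod>i\<in>R. b i) * (\<Prod>i\<in>R. if i \<in> {inv \<sigma> a, inv \<sigma> c} then q i else 1)"
        by (simp add: prod.distrib)
      also have "(\<Prod>i\<in>R. if i \<in> {inv \<sigma> a, inv \<sigma> c} then q i else 1) = (\<Prod>i\<in>{inv \<sigma> a, inv \<sigma> c}. q i)"
        using in_R fin by (subst prod.If_cases) (auto intro: prod.cong)
      finally show ?thesis using ne by simp
    qed
    then have "permanent R (\<lambda>i j. if j = a \<or> j = c then g i else b i)
        = (\<Sum>\<sigma> | \<sigma> permutes R. (\<Prod>i\<in>R. b i) * (q (inv \<sigma> a) * q (inv \<sigma> c)))"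
      unfolding permanent_def by (intro sum.cong) auto
    also have "\<dots> = (\<Prod>i\<in>R. b i) * X c"
      unfolding X_def sum_distrib_left[symmetric]
      by (subst (2) sum_permutations_inverse) simp
    finally show ?thesis .
  qed
  moreover have "(\<Prod>i\<in>R. b i) \<noteq> 0" using b fin by simp
  ultimately show ?thesis by simp
qed

section \<open>A nonvanishing criterion for products of affine forms\<close>

text \<open>The functional is the divided difference at \<open>k + 1\<close> points of \<open>A\<close>.\<close>

lemma moment_functional_exists:
  fixes A :: "real set"
  assumes "finite A" "k < card A"
  shows "\<exists>w. (\<forall>j<k. (\<Sum>a\<in>A. w a * a ^ j) = 0) \<and> (\<Sum>a\<in>A. w a * a ^ k) = 1"
  using assms
proof (induction k arbitrary: A)
  case 0
  then obtain z where z: "z \<in> A" by fastforce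
  show ?case
    using z 0 by (intro exI[of _ "\<lambda>a. if a = z then 1 else 0"]) simp
next
  case (Suc k)
  then obtain z where z: "z \<in> A" by fastforce
  have "k < card (A - {z})" using Suc.prems z by simp
  with Suc.IH[of "A - {z}"] Suc.prems obtain w where
    w0: "\<And>j. j < k \<Longrightarrow> (\<Sum>a\<in>A - {z}. w a * a ^ j) = 0" and
    w1: "(\<Sum>a\<in>A - {z}. w a * a ^ k) = 1" by auto
  \<comment> \<open>This applies \<open>w\<close> to the difference quotient
    \<open>(f a - f z) / (a - z)\<close>, which lowers the degree of a nonconstant polynomial
    \<open>f\<close> by one.\<close>
  define v where "v a = (if a = z then - (\<Sum>b\<in>A - {z}. w b / (b - z)) else w a / (a - z))" for a
  define m where "m j = (\<Sum>a\<in>A. v a * a ^ j)" for j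
  have "m 0 = v z + (\<Sum>a\<in>A - {z}. v a)"
    unfolding m_def using Suc.prems z by (simp add: sum.remove)
  also have "(\<Sum>a\<in>A - {z}. v a) = (\<Sum>a\<in>A - {z}. w a / (a - z))"
    by (intro sum.cong) (auto simp: v_def)
  finally have m0: "m 0 = 0" by (simp add: v_def)
  have step: "m (Suc j) = z * m j + (\<Sum>a\<in>A - {z}. w a * a ^ j)" for j
  proof -
    have "m (Suc j) - z * m j = (\<Sum>a\<in>A. v a * (a - z) * a ^ j)"
      unfolding m_def sum_distrib_left sum_subtractf[symmetric]
      by (intro sum.cong) (auto simp: algebra_simps)
    also have "\<dots> = (\<Sum>a\<in>A - {z}. v a * (a - z) * a ^ j)"
      using Suc.prems z by (simp add: sum.remove)
    also have "\<dots> = (\<Sum>a\<in>A - {z}. w a * a ^ j)"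
      by (intro sum.cong) (auto simp: v_def)
    finally show ?thesis by simp
  qed
  have "m j = 0" if "j \<le> k" for j
    using that by (induction j) (simp_all add: m0 step w0)
  moreover from this have "m (Suc k) = 1" using step[of k] w1 by simp
  ultimately show ?case unfolding m_def by (intro exI[of _ v]) auto
qed

text \<open>Expanding the permanent over the maps \<open>g : R \<rightarrow> E\<close> and grouping them by the multiset of their
  values yields a multiset \<open>M\<close> with multiplicities at most \<open>s\<close> such that the coefficient \<open>C M\<close> of the
  monomial \<open>M\<close> in the product of the forms is nonzero. As \<open>M\<close> has full degree, a product of moment
  functionals on the lists maps the product of the affine forms to \<open>C M\<close>.\<close>

lemma nonvanishing_of_permanent:
  fixes l :: "'r \<Rightarrow> 'e \<Rightarrow> real" and d :: "'r \<Rightarrow> 'e \<Rightarrow> real"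
  assumes finR: "finite R" and finE: "finite E"
    and lists: "\<And>e. e \<in> E \<Longrightarrow> finite (L e) \<and> card (L e) = Suc s"
    and usage: "\<And>e. e \<in> E \<Longrightarrow> card {j \<in> R. d j e \<noteq> 0} \<le> s"
    and per: "permanent R (\<lambda>i j. \<Sum>e\<in>E. d j e * l i e) \<noteq> 0"
  shows "\<exists>x. (\<forall>e\<in>E. x e \<in> L e) \<and> (\<forall>i\<in>R. (\<Sum>e\<in>E. l i e * x e) + c i \<noteq> 0)"
proof -
  define \<mu> where "\<mu> T g = image_mset g (mset_set T)" for T and g :: "'r \<Rightarrow> 'e"
  \<comment> \<open>Picking the summand \<open>g i\<close> in each row \<open>i\<close> of the
    permanent leaves \<open>\<Prod>i\<in>R. l i (g i)\<close> times \<open>Y g\<close>.\<close>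
  define Y where "Y g = (\<Sum>\<sigma> | \<sigma> permutes R. \<Prod>i\<in>R. d (\<sigma> i) (g i))" for g
  define G where "G = (R \<rightarrow>\<^sub>E E)"
  define C where "C M = (\<Sum>g | g \<in> G \<and> \<mu> R g = M. \<Prod>i\<in>R. l i (g i))" for M
  have finG: "finite G" by (simp add: G_def finR finE finite_PiE)
  have count_\<mu>: "count (\<mu> T g) e = card {i \<in> T. g i = e}" if "T \<subseteq> R" for T g e
    using that finR by (auto simp: \<mu>_def count_image_mset_eq_card_vimage finite_subset)
  \<comment> \<open>Maps with the same multiset of values differ by a permutation of
    \<open>R\<close>, which the sum over all permutations absorbs.\<close>
  have Y_cong: "Y g = Y h" if eq: "\<mu> R g = \<mu> R h" for g h
  proof -
    obtain p where p: "p permutes R" and ph: "\<forall>i\<in>R. g i = h (p i)"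
      by (rule image_mset_eq_implies_permutes[OF finR eq[unfolded \<mu>_def]])
    have "Y g = (\<Sum>\<sigma> | \<sigma> permutes R. \<Prod>i\<in>R. d (\<sigma> i) (h (p i)))"
      unfolding Y_def using ph by (intro sum.cong prod.cong) auto
    also have "\<dots> = (\<Sum>\<sigma> | \<sigma> permutes R. \<Prod>i\<in>R. d ((\<sigma> \<circ> p) i) (h (p i)))"
      by (rule sum_permutations_compose_right[OF p])
    also have "\<dots> = Y h"
      unfolding Y_def
      using prod.permute[OF p, of "\<lambda>i. d (\<sigma> i) (h i)" for \<sigma>] by (simp add: o_def)
    finally show ?thesis .
  qed
  \<comment> \<open>A nonzero term of \<open>Y g\<close> maps the rows choosing \<open>e\<close>
    injectively to columns whose direction involves \<open>e\<close>.\<close>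
  have Y_usage: "count (\<mu> R g) e \<le> s" if "Y g \<noteq> 0" "e \<in> E" for g e
  proof -
    obtain \<sigma> where \<sigma>: "\<sigma> permutes R" and "(\<Prod>i\<in>R. d (\<sigma> i) (g i)) \<noteq> 0"
      using \<open>Y g \<noteq> 0\<close> unfolding Y_def
      by (auto elim: sum.not_neutral_contains_not_neutral)
    then have "d (\<sigma> i) (g i) \<noteq> 0" if "i \<in> R" for i
      using that finR by auto
    then have "\<sigma> ` {i \<in> R. g i = e} \<subseteq> {j \<in> R. d j e \<noteq> 0}"
      using \<sigma> by (auto simp: permutes_in_image)
    then have "card (\<sigma> ` {i \<in> R. g i = e}) \<le> card {j \<in> R. d j e \<noteq> 0}"
      using finR by (intro card_mono) auto
    moreover have "card (\<sigma> ` {i \<in> R. g i = e}) = card {i \<in> R. g i = e}"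
      using permutes_inj[OF \<sigma>] by (intro card_image) (auto intro: inj_on_subset)
    ultimately show ?thesis using usage[OF \<open>e \<in> E\<close>] by (simp add: count_\<mu>)
  qed
  have "permanent R (\<lambda>i j. \<Sum>e\<in>E. d j e * l i e)
      = (\<Sum>\<sigma> | \<sigma> permutes R. \<Sum>g\<in>G. \<Prod>i\<in>R. d (\<sigma> i) (g i) * l i (g i))"
    unfolding permanent_def G_def by (simp add: prod_sum_PiE finR finE)
  also have "\<dots> = (\<Sum>g\<in>G. Y g * (\<Prod>i\<in>R. l i (g i)))"
    by (subst sum.swap) (simp add: Y_def sum_distrib_right prod.distrib)
  also have "\<dots> = (\<Sum>M\<in>\<mu> R ` G. \<Sum>g | g \<in> G \<and> \<mu> R g = M. Y g * (\<Prod>i\<in>R. l i (g i)))"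
    by (rule sum.group[symmetric]) (use finG in auto)
  finally have "(\<Sum>M\<in>\<mu> R ` G. \<Sum>g | g \<in> G \<and> \<mu> R g = M. Y g * (\<Prod>i\<in>R. l i (g i))) \<noteq> 0"
    using per by simp
  then obtain M where "M \<in> \<mu> R ` G"
    and nz: "(\<Sum>g | g \<in> G \<and> \<mu> R g = M. Y g * (\<Prod>i\<in>R. l i (g i))) \<noteq> 0"
    by (rule sum.not_neutral_contains_not_neutral)
  then obtain g0 where g0: "g0 \<in> G" and M_def: "M = \<mu> R g0" by auto
  have "(\<Sum>g | g \<in> G \<and> \<mu> R g = M. Y g * (\<Prod>i\<in>R. l i (g i))) = Y g0 * C M"
    unfolding C_def M_def sum_distrib_left by (intro sum.cong) (auto dest: Y_cong)
  with nz have "Y g0 \<noteq> 0" and C: "C M \<noteq> 0" by auto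
  then have "\<forall>e\<in>E. \<exists>w. (\<forall>j<count M e. (\<Sum>a\<in>L e. w a * a ^ j) = 0) \<and> (\<Sum>a\<in>L e. w a * a ^ count M e) = 1"
    using Y_usage lists unfolding M_def by (intro ballI moment_functional_exists) (auto simp: le_imp_less_Suc)
  then obtain w where
    w0: "\<And>e j. e \<in> E \<Longrightarrow> j < count M e \<Longrightarrow> (\<Sum>a\<in>L e. w e a * a ^ j) = 0" and
    w1: "\<And>e. e \<in> E \<Longrightarrow> (\<Sum>a\<in>L e. w e a * a ^ count M e) = 1"
    by metis
  define X where "X = PiE E L"
  have finX: "finite X" unfolding X_def using lists finE by (intro finite_PiE) auto
  define W where "W x = (\<Prod>e\<in>E. w e (x e))" for x
  \<comment> \<open>Expanding the product of affine forms selects a set \<open>T\<close> of factors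
    that contribute their linear part; the other factors contribute constants.\<close>
  define \<Phi> where "\<Phi> T = (\<Sum>x\<in>X. W x * (\<Prod>i\<in>T. \<Sum>e\<in>E. l i e * x e))" for T
  have \<Phi>: "\<Phi> T = (\<Sum>g | g \<in> (T \<rightarrow>\<^sub>E E) \<and> \<mu> T g = M. \<Prod>i\<in>T. l i (g i))" if T: "T \<subseteq> R" for T
  proof -
    have finT: "finite T" using T finR finite_subset by auto
    have mon: "(\<Sum>x\<in>X. W x * (\<Prod>i\<in>T. x (g i))) = (if \<mu> T g = M then 1 else 0)"
      if g: "g \<in> (T \<rightarrow>\<^sub>E E)" for g
    proof -
      have "(\<Prod>i\<in>T. x (g i)) = (\<Prod>e\<in>E. x e ^ count (\<mu> T g) e)" for x :: "'e \<Rightarrow> real"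
      proof -
        have "(\<Prod>i\<in>T. x (g i)) = (\<Prod>e\<in>E. \<Prod>i | i \<in> T \<and> g i = e. x (g i))"
          by (rule prod.group[symmetric]) (use g finT finE in auto)
        also have "\<dots> = (\<Prod>e\<in>E. x e ^ count (\<mu> T g) e)"
          by (intro prod.cong) (simp_all add: count_\<mu>[OF T])
        finally show ?thesis .
      qed
      then have "(\<Sum>x\<in>X. W x * (\<Prod>i\<in>T. x (g i)))
          = (\<Sum>x\<in>X. \<Prod>e\<in>E. w e (x e) * x e ^ count (\<mu> T g) e)"
        by (simp add: W_def prod.distrib)
      also have "\<dots> = (\<Prod>e\<in>E. \<Sum>a\<in>L e. w e a * a ^ count (\<mu> T g) e)"
        unfolding X_def by (rule prod_sum_PiE[symmetric]) (use lists finE in auto)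
      also have "\<dots> = (if \<mu> T g = M then 1 else 0)"
      proof (cases "\<mu> T g = M")
        case True
        then show ?thesis by (simp add: w1)
      next
        case False
        \<comment> \<open>The degree is at most that of \<open>M\<close>, so a monomial other than
          \<open>M\<close> falls short of \<open>M\<close> in some exponent, and there the moment
          vanishes.\<close>
        have "\<exists>e\<in>E. count (\<mu> T g) e < count M e"
        proof (rule ccontr)
          assume "\<not> ?thesis"
          moreover have "set_mset M \<subseteq> E"
            using g0 finR by (auto simp: M_def \<mu>_def G_def)
          ultimately have "count M e \<le> count (\<mu> T g) e" for e
            by (cases "e \<in> E") (force simp: not_less, metis count_eq_zero_iff le0 subsetD)
          then have "M \<subseteq># \<mu> T g" by (simp add: subseteq_mset_def)
          moreover have "size (\<mu> T g) \<le> size M"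
            using T finR by (simp add: \<mu>_def M_def card_mono)
          ultimately show False
            using False mset_subset_size[of M "\<mu> T g"] by (auto simp: subset_mset.less_le)
        qed
        then have "(\<Prod>e\<in>E. \<Sum>a\<in>L e. w e a * a ^ count (\<mu> T g) e) = 0"
          using w0 finE by (intro prod_zero) auto
        then show ?thesis using False by simp
      qed
      finally show ?thesis .
    qed
    have "\<Phi> T = (\<Sum>x\<in>X. \<Sum>g\<in>T \<rightarrow>\<^sub>E E. W x * ((\<Prod>i\<in>T. l i (g i)) * (\<Prod>i\<in>T. x (g i))))"
      unfolding \<Phi>_def by (simp add: prod_sum_PiE finT finE sum_distrib_left prod.distrib)
    also have "\<dots> = (\<Sum>g\<in>T \<rightarrow>\<^sub>E E. (\<Prod>i\<in>T. l i (g i)) * (\<Sum>x\<in>X. W x * (\<Prod>i\<in>T. x (g i))))"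
      by (subst sum.swap) (simp add: sum_distrib_left mult_ac)
    also have "\<dots> = (\<Sum>g\<in>T \<rightarrow>\<^sub>E E. if \<mu> T g = M then \<Prod>i\<in>T. l i (g i) else 0)"
      by (intro sum.cong refl) (simp add: mon)
    also have "\<dots> = (\<Sum>g | g \<in> (T \<rightarrow>\<^sub>E E) \<and> \<mu> T g = M. \<Prod>i\<in>T. l i (g i))"
      using finT finE by (simp add: sum.inter_filter finite_PiE)
    finally show ?thesis .
  qed
  have \<Phi>_proper: "\<Phi> T = 0" if "T \<in> Pow R - {R}" for T
  proof -
    have "T \<subset> R" using that by auto
    then have "size (\<mu> T g) \<noteq> size M" for g
      using finR psubset_card_mono[of R T] by (simp add: \<mu>_def M_def)
    then have "\<mu> T g \<noteq> M" for g by metis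
    then show ?thesis using \<Phi>[of T] \<open>T \<subset> R\<close> by simp
  qed
  have "(\<Sum>x\<in>X. W x * (\<Prod>i\<in>R. (\<Sum>e\<in>E. l i e * x e) + c i))
      = (\<Sum>T\<in>Pow R. \<Phi> T * (\<Prod>i\<in>R - T. c i))"
    unfolding prod_add[OF finR] \<Phi>_def sum_distrib_left sum_distrib_right
    by (subst sum.swap) (simp add: mult_ac)
  also have "\<dots> = \<Phi> R"
    using finR \<Phi>_proper by (subst sum.remove[of _ R]) auto
  also have "\<dots> = C M" by (simp add: \<Phi> C_def G_def)
  finally have "(\<Sum>x\<in>X. W x * (\<Prod>i\<in>R. (\<Sum>e\<in>E. l i e * x e) + c i)) \<noteq> 0"
    using C by simp
  then obtain x where "x \<in> X" "W x * (\<Prod>i\<in>R. (\<Sum>e\<in>E. l i e * x e) + c i) \<noteq> 0"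
    by (rule sum.not_neutral_contains_not_neutral)
  then show ?thesis using finR by (intro exI[of _ x]) (auto simp: X_def)
qed

section \<open>Directions in weight space\<close>

text \<open>The orientation is arbitrary; it fixes the sign of each colour difference.\<close>

locale oriented_graph =
  fixes E :: "'a set set" and src tgt :: "'a set \<Rightarrow> 'a"
  assumes finE: "finite E"
    and ends: "e \<in> E \<Longrightarrow> e = {src e, tgt e}"
    and ends_neq: "e \<in> E \<Longrightarrow> src e \<noteq> tgt e"
begin

text \<open>The coefficient of the weight of \<open>q\<close> in the colour difference along
  \<open>i\<close>. For an edge \<open>q = i\<close> it is 0, as both ends receive that
  weight.\<close>

definition inc :: "'a set \<Rightarrow> 'a set \<Rightarrow> real" where
  "inc q i = of_bool (src i \<in> q) - of_bool (tgt i \<in> q)"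

text \<open>The difference between the colours of the two ends of \<open>i\<close> induced by the edge weights \<open>d\<close>.\<close>

definition effect :: "('a set \<Rightarrow> real) \<Rightarrow> 'a set \<Rightarrow> real" where
  "effect d i = (\<Sum>e\<in>E. d e * inc e i)"

definition single :: "'a set \<Rightarrow> 'a set \<Rightarrow> real" where
  "single q e = of_bool (e = q)"

definition shift :: "'a \<Rightarrow> 'a \<Rightarrow> 'a \<Rightarrow> 'a set \<Rightarrow> real" where
  "shift u v w e = single {u, w} e - single {v, w} e"

text \<open>Columns are indexed by the rows themselves, one direction for each. The budget
  \<open>u\<close> varies with the edge so that the costs of successive blocks can be added.\<close>

definition feasible :: "'a set set \<Rightarrow> ('a set \<Rightarrow> nat) \<Rightarrow> bool" where
  "feasible R u \<longleftrightarrow>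
     (\<exists>d. permanent R (\<lambda>i j. effect (d j) i) \<noteq> 0 \<and> (\<forall>e. card {j \<in> R. d j e \<noteq> 0} \<le> u e))"

definition edges_in :: "'a set \<Rightarrow> 'a set set" where
  "edges_in S = {e \<in> E. e \<subseteq> S}"

text \<open>The weight of an edge does not affect its own colour difference, so the edges of a component
  \<open>K\<^sub>2\<close> cannot be rows of a matrix that uses only edges within \<open>S\<close>.\<close>

definition isolated :: "'a set \<Rightarrow> 'a set set" where
  "isolated S = {e \<in> edges_in S. \<forall>f\<in>edges_in S. f \<inter> e \<noteq> {} \<longrightarrow> f = e}"

definition rows :: "'a set \<Rightarrow> 'a set set" where
  "rows S = edges_in S - isolated S"

definition deg :: "'a set \<Rightarrow> 'a \<Rightarrow> nat" where
  "deg S v = card {e \<in> edges_in S. v \<in> e}"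

text \<open>The middle vertex \<open>w\<close> is recorded because the shift runs through
  it.\<close>

definition dist2 :: "'a set \<Rightarrow> 'a \<Rightarrow> 'a \<Rightarrow> 'a \<Rightarrow> bool" where
  "dist2 S u v w \<longleftrightarrow> u \<in> S \<and> v \<in> S \<and> w \<in> S \<and> u \<noteq> v \<and> {u, w} \<in> E \<and> {v, w} \<in> E \<and> {u, v} \<notin> E"

lemma finite_edges_in [simp]: "finite (edges_in S)"
  using finE by (simp add: edges_in_def)

lemma finite_rows [simp]: "finite (rows S)"
  by (simp add: rows_def)

lemma finite_isolated [simp]: "finite (isolated S)"
  by (simp add: isolated_def)

lemma edge_neq: "{a, b} \<in> E \<Longrightarrow> a \<noteq> b"
  using ends[of "{a, b}"] ends_neq[of "{a, b}"] by auto

lemma edge_other_end: "\<lbrakk>e \<in> E; a \<in> e\<rbrakk> \<Longrightarrow> \<exists>b. b \<noteq> a \<and> e = {a, b}"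
  using ends[of e] ends_neq[of e] by (metis insert_commute insertE singletonD)

lemma pair_ends:
  assumes "{a, b} \<in> E"
  shows "src {a, b} = a \<and> tgt {a, b} = b \<or> src {a, b} = b \<and> tgt {a, b} = a"
  using ends[OF assms] by (metis doubleton_eq_iff)

lemma inc_eq_0_iff: "{a, b} \<in> E \<Longrightarrow> inc q {a, b} = 0 \<longleftrightarrow> (a \<in> q \<longleftrightarrow> b \<in> q)"
  using pair_ends[of a b] by (auto simp: inc_def)

lemma inc_disjoint: "\<lbrakk>i \<in> E; i \<inter> q = {}\<rbrakk> \<Longrightarrow> inc q i = 0"
  using ends[of i] by (auto simp: inc_def)

lemma effect_single: "q \<in> E \<Longrightarrow> effect (single q) i = inc q i"
  using finE by (simp add: effect_def single_def of_bool_def if_distrib if_distribR cong: if_cong)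

text \<open>The colour of the middle vertex \<open>w\<close> is unchanged.\<close>

lemma effect_shift:
  assumes "{u, w} \<in> E" "{v, w} \<in> E" "u \<noteq> v"
  shows "effect (shift u v w) i
      = of_bool (src i = u) - of_bool (src i = v) - of_bool (tgt i = u) + of_bool (tgt i = v)"
proof -
  have "effect (shift u v w) i = effect (single {u, w}) i - effect (single {v, w}) i"
    by (simp add: effect_def shift_def left_diff_distrib sum_subtractf)
  also have "\<dots> = inc {u, w} i - inc {v, w} i"
    using assms by (simp add: effect_single)
  also have "\<dots> = of_bool (src i = u) - of_bool (src i = v) - of_bool (tgt i = u) + of_bool (tgt i = v)"
    using edge_neq[OF assms(1)] edge_neq[OF assms(2)] assms(3) by (auto simp: inc_def)
  finally show ?thesis .
qed

text \<open>Nothing cancels: an edge meeting exactly one of \<open>u\<close>, \<open>v\<close> gets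
  1 or -1, and on an edge joining them the two contributions have the same sign.\<close>

lemma effect_shift_eq_0_iff:
  assumes "{u, w} \<in> E" "{v, w} \<in> E" "u \<noteq> v" "i \<in> E"
  shows "effect (shift u v w) i = 0 \<longleftrightarrow> u \<notin> i \<and> v \<notin> i"
proof -
  have "u \<in> i \<longleftrightarrow> src i = u \<or> tgt i = u" "v \<in> i \<longleftrightarrow> src i = v \<or> tgt i = v"
    using ends[OF assms(4)] by (metis insert_iff singletonD)+
  then show ?thesis
    using effect_shift[OF assms(1-3), of i] ends_neq[OF assms(4)] assms(3) by auto
qed

section \<open>Building up feasible sets of rows block by block\<close>

lemma feasible_empty: "feasible {} u"
  by (simp add: feasible_def)

lemma feasible_mono: "\<lbrakk>feasible R u; \<And>e. u e \<le> v e\<rbrakk> \<Longrightarrow> feasible R v"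
  unfolding feasible_def by (meson order_trans)

text \<open>The directions of \<open>R1\<close> are invisible in the rows \<open>R2\<close>, so the
  matrix is block triangular and the permanents multiply, whatever the old directions do to the rows
  \<open>R1\<close>.\<close>

lemma feasible_add:
  assumes fin: "finite R1" "finite R2" and disj: "R1 \<inter> R2 = {}"
    and per: "permanent R1 (\<lambda>i j. effect (d j) i) \<noteq> 0"
    and zero: "\<And>i j. i \<in> R2 \<Longrightarrow> j \<in> R1 \<Longrightarrow> effect (d j) i = 0"
    and feas: "feasible R2 u"
  shows "feasible (R1 \<union> R2) (\<lambda>e. card {j \<in> R1. d j e \<noteq> 0} + u e)"
proof -
  from feas obtain d2 where d2: "permanent R2 (\<lambda>i j. effect (d2 j) i) \<noteq> 0"
    and u: "\<And>e. card {j \<in> R2. d2 j e \<noteq> 0} \<le> u e"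
    unfolding feasible_def by blast
  define d' where "d' j = (if j \<in> R1 then d j else d2 j)" for j
  have "permanent (R1 \<union> R2) (\<lambda>i j. effect (d' j) i)
      = permanent R1 (\<lambda>i j. effect (d' j) i) * permanent R2 (\<lambda>i j. effect (d' j) i)"
    by (rule permanent_block) (use fin disj zero in \<open>auto simp: d'_def\<close>)
  also have "permanent R1 (\<lambda>i j. effect (d' j) i) = permanent R1 (\<lambda>i j. effect (d j) i)"
    by (rule permanent_cong) (simp add: d'_def)
  also have "permanent R2 (\<lambda>i j. effect (d' j) i) = permanent R2 (\<lambda>i j. effect (d2 j) i)"
    by (rule permanent_cong) (use disj in \<open>auto simp: d'_def\<close>)
  finally have "permanent (R1 \<union> R2) (\<lambda>i j. effect (d' j) i) \<noteq> 0"
    using per d2 by simp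
  moreover have "card {j \<in> R1 \<union> R2. d' j e \<noteq> 0} \<le> card {j \<in> R1. d j e \<noteq> 0} + u e" for e
  proof -
    have "{j \<in> R1 \<union> R2. d' j e \<noteq> 0} = {j \<in> R1. d j e \<noteq> 0} \<union> {j \<in> R2. d2 j e \<noteq> 0}"
      using disj by (auto simp: d'_def)
    then have "card {j \<in> R1 \<union> R2. d' j e \<noteq> 0} \<le> card {j \<in> R1. d j e \<noteq> 0} + card {j \<in> R2. d2 j e \<noteq> 0}"
      by (simp add: card_Un_le)
    then show ?thesis using u[of e] by linarith
  qed
  ultimately show ?thesis unfolding feasible_def by blast
qed

text \<open>The columns of the new block are all equal, so its permanent is a factorial times a
  product of nonzero effects. Each weight involved in \<open>D\<close> pays once per row of
  \<open>R1\<close>.\<close>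

lemma feasible_add_direction:
  assumes fin: "finite R1" "finite R2" and disj: "R1 \<inter> R2 = {}"
    and nz: "\<And>i. i \<in> R1 \<Longrightarrow> effect D i \<noteq> 0"
    and zero: "\<And>i. i \<in> R2 \<Longrightarrow> effect D i = 0"
    and feas: "feasible R2 u"
  shows "feasible (R1 \<union> R2) (\<lambda>e. (if D e \<noteq> 0 then card R1 else 0) + u e)"
proof -
  have "permanent R1 (\<lambda>i j. effect D i) \<noteq> 0"
    using nz fin by (subst permanent_const[where b = "effect D"]) auto
  from feasible_add[OF fin disj this zero feas] show ?thesis
    by (rule feasible_mono) auto
qed

text \<open>Each new direction affects only its own row among \<open>N \<union> R\<close>, so the
  rows of \<open>N\<close> are added one at a time as blocks of size one.\<close>

lemma feasible_add_family:
  assumes "finite N" "finite R" "N \<inter> R = {}"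
    and "\<And>r. r \<in> N \<Longrightarrow> effect (h r) r \<noteq> 0"
    and "\<And>r i. r \<in> N \<Longrightarrow> i \<in> N \<union> R \<Longrightarrow> i \<noteq> r \<Longrightarrow> effect (h r) i = 0"
    and "feasible R u"
  shows "feasible (N \<union> R) (\<lambda>e. card {r \<in> N. h r e \<noteq> 0} + u e)"
  using assms
proof (induction N rule: finite_induct)
  case empty
  then show ?case by simp
next
  case (insert r N)
  have "feasible (N \<union> R) (\<lambda>e. card {r \<in> N. h r e \<noteq> 0} + u e)"
    using insert by auto
  then have "feasible ({r} \<union> (N \<union> R)) (\<lambda>e. (if h r e \<noteq> 0 then card {r} else 0) + (card {r \<in> N. h r e \<noteq> 0} + u e))"
    by (rule feasible_add_direction[rotated -1]) (use insert in auto)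
  then have "feasible (insert r N \<union> R) (\<lambda>e. (if h r e \<noteq> 0 then card {r} else 0) + (card {r \<in> N. h r e \<noteq> 0} + u e))"
    by simp
  then show ?case
  proof (rule feasible_mono)
    fix e
    have "{r' \<in> insert r N. h r' e \<noteq> 0} = (if h r e \<noteq> 0 then {r} else {}) \<union> {r' \<in> N. h r' e \<noteq> 0}"
      by auto
    then show "(if h r e \<noteq> 0 then card {r} else 0) + (card {r \<in> N. h r e \<noteq> 0} + u e)
        \<le> card {r' \<in> insert r N. h r' e \<noteq> 0} + u e"
      using insert.hyps by simp
  qed
qed

section \<open>Edges that become isolated when two vertices are removed\<close>

lemma rows_remove_two:
  assumes "\<And>e. \<lbrakk>e \<in> edges_in S; x \<in> e \<or> y \<in> e\<rbrakk> \<Longrightarrow> e \<notin> isolated S"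
  shows "rows S = {e \<in> edges_in S. x \<in> e \<or> y \<in> e} \<union>
    ((isolated (S - {x, y}) - isolated S) \<union> rows (S - {x, y}))"
proof -
  have "edges_in S = {e \<in> edges_in S. x \<in> e \<or> y \<in> e} \<union> edges_in (S - {x, y})"
    by (auto simp: edges_in_def)
  \<comment> \<open>An edge meeting \<open>e\<close> in the smaller set also meets it in
    \<open>S\<close>, so a removal can create isolated edges but cannot destroy the isolation of a
    surviving one.\<close>
  moreover have "e \<notin> isolated S" if "e \<in> rows (S - {x, y})" for e
    using that by (auto simp: rows_def isolated_def edges_in_def)
  moreover have "isolated (S - {x, y}) \<subseteq> edges_in (S - {x, y})"
    by (auto simp: isolated_def)
  ultimately show ?thesis
    using assms unfolding rows_def by blast
qed

text \<open>Some other edge of \<open>S\<close> meets \<open>r\<close> and is lost in the removal,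
  so it contains a removed vertex. As \<open>r\<close> avoids that vertex, the other end lies on
  \<open>r\<close>.\<close>

lemma new_isolated_edge:
  assumes "r \<in> isolated (S - {x, y}) - isolated S"
  obtains p z where "p \<in> {x, y}" "z \<in> r" "{p, z} \<in> edges_in S"
proof -
  from assms have r: "r \<in> isolated (S - {x, y})" "r \<in> edges_in S" "r \<notin> isolated S"
    by (auto simp: isolated_def edges_in_def)
  then obtain f where f: "f \<in> edges_in S" "f \<inter> r \<noteq> {}" "f \<noteq> r"
    by (auto simp: isolated_def)
  have "f \<notin> edges_in (S - {x, y})" using r(1) f by (auto simp: isolated_def)
  then obtain p where p: "p \<in> f" "p \<in> {x, y}" using f(1) by (auto simp: edges_in_def)
  then obtain z where z: "f = {p, z}" using f(1) edge_other_end[of f p] by (auto simp: edges_in_def)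
  have "p \<notin> r" using p(2) r(1) by (auto simp: isolated_def edges_in_def)
  then have "z \<in> r" using z f(2) by auto
  then show ?thesis using that p(2) z f(1) by blast
qed

lemma isolated_eqI: "\<lbrakk>r \<in> isolated S; i \<in> edges_in S; z \<in> i; z \<in> r\<rbrakk> \<Longrightarrow> i = r"
  by (auto simp: isolated_def)

text \<open>The weight of \<open>q r\<close> reaches exactly one end of \<open>r\<close>, so it
  changes the colour difference there. It reaches no other remaining edge, because \<open>r\<close>
  is isolated after the removal.\<close>

lemma feasible_add_new_isolated:
  fixes S x y
  defines "S' \<equiv> S - {x, y}"
  defines "N \<equiv> isolated S' - isolated S"
  assumes feas: "feasible (rows S') u"
    and q: "\<And>r. r \<in> N \<Longrightarrow> q r \<in> E \<and> (\<exists>p\<in>{x, y}. \<exists>z\<in>r. q r = {p, z})"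
  shows "feasible (N \<union> rows S') (\<lambda>e. of_bool (e \<in> q ` N) + u e)"
proof -
  have rE: "r \<in> edges_in S'" if "r \<in> N \<union> rows S'" for r
    using that by (auto simp: N_def rows_def isolated_def)
  have nz: "effect (single (q r)) r \<noteq> 0" if r: "r \<in> N" for r
  proof -
    obtain p z where pz: "p \<in> {x, y}" "z \<in> r" "q r = {p, z}" and qE: "q r \<in> E"
      using q[OF r] by blast
    have "r \<in> E" "r \<subseteq> S'" using rE r by (auto simp: edges_in_def)
    then obtain z' where z': "z' \<noteq> z" "r = {z, z'}" using edge_other_end pz(2) by blast
    then show ?thesis
      using pz \<open>r \<in> E\<close> \<open>r \<subseteq> S'\<close> inc_eq_0_iff[of z z' "q r"] effect_single[OF qE] by (auto simp: S'_def)
  qed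
  have zero: "effect (single (q r)) i = 0" if r: "r \<in> N" and i: "i \<in> N \<union> rows S'" "i \<noteq> r" for r i
  proof -
    obtain p z where pz: "p \<in> {x, y}" "z \<in> r" "q r = {p, z}" and qE: "q r \<in> E"
      using q[OF r] by blast
    have "z \<notin> i" using isolated_eqI[of r S' i z] r rE[OF i(1)] i(2) pz(2) by (auto simp: N_def)
    moreover have "p \<notin> i" using rE[OF i(1)] pz(1) by (auto simp: edges_in_def S'_def)
    ultimately show ?thesis
      using effect_single[OF qE] inc_disjoint[of i "q r"] rE[OF i(1)] pz(3) by (auto simp: edges_in_def)
  qed
  have "feasible (N \<union> rows S') (\<lambda>e. card {r \<in> N. single (q r) e \<noteq> 0} + u e)"
    by (rule feasible_add_family) (use nz zero feas in \<open>auto simp: N_def rows_def\<close>)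
  then show ?thesis
  proof (rule feasible_mono)
    fix e
    \<comment> \<open>The end of \<open>q r\<close> outside \<open>{x, y}\<close> lies on
      \<open>r\<close>, and isolated edges sharing a vertex coincide, so no weight is charged
      twice.\<close>
    have inj: "r = r'" if "r \<in> N" "r' \<in> N" "q r = q r'" for r r'
    proof -
      obtain p z where pz: "p \<in> {x, y}" "z \<in> r" "q r = {p, z}" using q[OF \<open>r \<in> N\<close>] by blast
      obtain p' z' where pz': "p' \<in> {x, y}" "z' \<in> r'" "q r' = {p', z'}" using q[OF \<open>r' \<in> N\<close>] by blast
      have "z \<in> S'" "z' \<in> S'" using rE that pz(2) pz'(2) by (auto simp: edges_in_def)
      then have "z = z'" using pz pz' \<open>q r = q r'\<close> by (auto simp: S'_def doubleton_eq_iff)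
      then show ?thesis
        using isolated_eqI[of r' S' r z] that rE[of r] pz(2) pz'(2) by (auto simp: N_def)
    qed
    have "{r \<in> N. single (q r) e \<noteq> 0} = {r \<in> N. q r = e}" by (auto simp: single_def)
    also have "card \<dots> \<le> of_bool (e \<in> q ` N)"
    proof (cases "e \<in> q ` N")
      case True
      then obtain r where "r \<in> N" "e = q r" by auto
      then have "{r \<in> N. q r = e} = {r}" using inj by auto
      then show ?thesis using True by simp
    next
      case False
      then have "{r \<in> N. q r = e} = {}" by auto
      then show ?thesis by (metis card.empty le0)
    qed
    finally show "card {r \<in> N. single (q r) e \<noteq> 0} + u e \<le> of_bool (e \<in> q ` N) + u e" by simp
  qed
qed

subsection \<open>Removing two vertices\<close>

text \<open>The value 0 outside \<open>edges_in S\<close> keeps the edges at removed vertices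
  unspent, so a removal step can draw on their full budget \<open>s\<close>.\<close>

definition bounded_usage :: "nat \<Rightarrow> 'a set \<Rightarrow> 'a set \<Rightarrow> nat" where
  "bounded_usage s S e = (if e \<in> edges_in S then s else 0)"

lemma dist2_edges_in:
  assumes "dist2 S u v w"
  shows "{u, w} \<in> edges_in S" "{v, w} \<in> edges_in S" "{u, w} \<in> E" "{v, w} \<in> E"
    "u \<noteq> v" "u \<noteq> w" "v \<noteq> w"
  using assms edge_neq by (auto simp: dist2_def edges_in_def)

lemma not_isolatedI:
  assumes "e \<in> edges_in S" "f \<in> edges_in S" "f \<noteq> e" "z \<in> e" "z \<in> f"
  shows "e \<notin> isolated S"
  using assms by (auto simp: isolated_def)

text \<open>The exceptional case of the next lemma: the only edges that could serve the new isolated edge \<open>r\<close>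
  are already used up by the shift.\<close>

lemma feasible_star:
  fixes S u v w r
  defines "S' \<equiv> S - {u, v}"
  assumes d: "dist2 S u v w" and s: "2 \<le> s"
    and du: "\<And>e. e \<in> edges_in S \<Longrightarrow> u \<in> e \<Longrightarrow> e = {u, w}"
    and dv: "\<And>e. e \<in> edges_in S \<Longrightarrow> v \<in> e \<Longrightarrow> e = {v, w}"
    and r: "r \<in> isolated S'" and wr: "w \<in> r"
    and feas: "feasible (rows S') (bounded_usage s S')"
  shows "feasible (rows S) (bounded_usage s S)"
proof -
  note d' = dist2_edges_in[OF d]
  have r': "r \<in> edges_in S'" "r \<in> edges_in S" "r \<in> E" "u \<notin> r" "v \<notin> r"
    using r by (auto simp: isolated_def edges_in_def S'_def)
  obtain b where b: "b \<noteq> w" "r = {w, b}" using edge_other_end[OF r'(3) wr] by blast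
  have T: "{e \<in> edges_in S. u \<in> e \<or> v \<in> e} = {{u, w}, {v, w}}"
  proof
    show "{e \<in> edges_in S. u \<in> e \<or> v \<in> e} \<subseteq> {{u, w}, {v, w}}" using du dv by blast
    show "{{u, w}, {v, w}} \<subseteq> {e \<in> edges_in S. u \<in> e \<or> v \<in> e}" using d'(1,2) by simp
  qed
  have uw_vw: "{u, w} \<noteq> {v, w}" using d' by (auto simp: doubleton_eq_iff)
  have not_iso: "{u, w} \<notin> isolated S" "{v, w} \<notin> isolated S" "r \<notin> isolated S"
    using not_isolatedI[OF d'(1) d'(2), of w] not_isolatedI[OF d'(2) d'(1), of w]
      not_isolatedI[OF r'(2) d'(2), of w] uw_vw wr r' by auto
  have "isolated S' - isolated S = {r}"
  proof -
    have "r' = r" if r'': "r' \<in> isolated S' - isolated S" for r'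
    proof -
      obtain p z where pz: "p \<in> {u, v}" "z \<in> r'" "{p, z} \<in> edges_in S"
        by (rule new_isolated_edge[OF r''[unfolded S'_def]])
      have "{p, z} = {p, w}" using pz(1)
      proof (elim insertE emptyE)
        assume "p = u"
        then show ?thesis using du[OF pz(3)] by simp
      next
        assume "p = v"
        then show ?thesis using dv[OF pz(3)] by simp
      qed
      then have "z = w" by (metis doubleton_eq_iff)
      then show ?thesis
        using \<open>z \<in> r'\<close> wr r r'' by (intro isolated_eqI[of r S' r' w]) (auto simp: isolated_def)
    qed
    then show ?thesis using r not_iso(3) by blast
  qed
  moreover have "rows S = {e \<in> edges_in S. u \<in> e \<or> v \<in> e} \<union> ((isolated S' - isolated S) \<union> rows S')"
    unfolding S'_def by (rule rows_remove_two) (use du dv not_iso in blast)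
  ultimately have rows: "rows S = {{u, w}, {v, w}} \<union> ({r} \<union> rows S')"
    unfolding T by simp
  have rowsE: "i \<in> edges_in S'" "i \<in> E" "w \<notin> i" "u \<notin> i" "v \<notin> i" if "i \<in> rows S'" for i
    using that isolated_eqI[OF r, of i w] wr r by (auto simp: rows_def edges_in_def S'_def)
  have zero: "effect (single {p, w}) i = 0" if "i \<in> rows S'" "p \<in> {u, v}" for i p
    using that rowsE[OF that(1)] d' by (auto simp: effect_single intro!: inc_disjoint)
  \<comment> \<open>The weight of \<open>{v, w}\<close> serves the row \<open>{u, w}\<close>. The
    weight of \<open>{u, w}\<close> has no effect on its own row and serves both
    \<open>{v, w}\<close> and \<open>r\<close>, which costs 2.\<close>
  have "feasible ({{u, w}} \<union> rows S')
      (\<lambda>e. (if single {v, w} e \<noteq> 0 then card {{u, w}} else 0) + bounded_usage s S' e)"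
  proof (rule feasible_add_direction)
    show "{{u, w}} \<inter> rows S' = {}" using rowsE by blast
    show "effect (single {v, w}) i \<noteq> 0" if "i \<in> {{u, w}}" for i
      using that d' by (auto simp: effect_single inc_eq_0_iff)
    show "effect (single {v, w}) i = 0" if "i \<in> rows S'" for i
      using zero[OF that] by simp
  qed (use feas in auto)
  then have "feasible ({{v, w}, r} \<union> ({{u, w}} \<union> rows S'))
      (\<lambda>e. (if single {u, w} e \<noteq> 0 then card {{v, w}, r} else 0)
        + ((if single {v, w} e \<noteq> 0 then card {{u, w}} else 0) + bounded_usage s S' e))"
  proof (rule feasible_add_direction[rotated -1])
    show "{{v, w}, r} \<inter> ({{u, w}} \<union> rows S') = {}"
      using rowsE uw_vw r' r by (auto simp: rows_def)
    show "effect (single {u, w}) i \<noteq> 0" if "i \<in> {{v, w}, r}" for i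
      using that d' r' b by (auto simp: effect_single inc_eq_0_iff)
    show "effect (single {u, w}) i = 0" if "i \<in> {{u, w}} \<union> rows S'" for i
    proof (cases "i = {u, w}")
      case True
      then show ?thesis using d' by (simp add: effect_single inc_eq_0_iff)
    next
      case False
      then show ?thesis using that zero[of i u] by simp
    qed
  qed auto
  moreover have "{{v, w}, r} \<union> ({{u, w}} \<union> rows S') = rows S" using rows by auto
  moreover have "card {{v, w}, r} = 2" using r' by (auto simp: card_insert_if)
  ultimately have "feasible (rows S) (\<lambda>e. (if e = {u, w} then 2 else 0)
      + ((if e = {v, w} then 1 else 0) + bounded_usage s S' e))"
    by (simp add: single_def cong: if_cong)
  moreover have "edges_in S' \<subseteq> edges_in S" "{u, w} \<notin> edges_in S'" "{v, w} \<notin> edges_in S'"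
    by (auto simp: edges_in_def S'_def)
  then have "(if e = {u, w} then 2 else 0) + ((if e = {v, w} then 1 else 0) + bounded_usage s S' e)
      \<le> bounded_usage s S e" for e
    using d'(1,2) s uw_vw by (auto simp: bounded_usage_def)
  ultimately show ?thesis by (rule feasible_mono)
qed

text \<open>The shift serves all edges at \<open>u\<close> or \<open>v\<close> and may exhaust the
  weights of \<open>{u, w}\<close> and \<open>{v, w}\<close>. Hence a new isolated edge must be
  served by an edge from \<open>u\<close> or \<open>v\<close> that avoids \<open>w\<close>. If one
  has no such edge, minimality makes \<open>u\<close> and \<open>v\<close> leaves at
  \<open>w\<close>.\<close>

lemma feasible_dist2_step:
  fixes S u v w
  defines "S' \<equiv> S - {u, v}"
  assumes d: "dist2 S u v w" and s: "2 \<le> s" and deg: "deg S u + deg S v \<le> s"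
    and min: "\<And>u' v' w'. dist2 S u' v' w' \<Longrightarrow> deg S u + deg S v \<le> deg S u' + deg S v'"
    and feas: "feasible (rows S') (bounded_usage s S')"
  shows "feasible (rows S) (bounded_usage s S)"
proof -
  note d' = dist2_edges_in[OF d]
  define T where "T = {e \<in> edges_in S. u \<in> e \<or> v \<in> e}"
  define N where "N = isolated S' - isolated S"
  have uw_vw: "{u, w} \<noteq> {v, w}" using d' by (auto simp: doubleton_eq_iff)
  have not_iso: "e \<notin> isolated S" if "e \<in> edges_in S" "u \<in> e \<or> v \<in> e" for e
    using that not_isolatedI[OF that(1) d'(1), of u] not_isolatedI[OF that(1) d'(2), of v]
      not_isolatedI[OF that(1) d'(1), of w] not_isolatedI[OF that(1) d'(2), of w] uw_vw by auto
  have rows: "rows S = T \<union> (N \<union> rows S')"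
    unfolding S'_def T_def N_def by (rule rows_remove_two) (rule not_iso)
  show ?thesis
  proof (cases "\<forall>r\<in>N. \<exists>p\<in>{u, v}. \<exists>z\<in>r. z \<noteq> w \<and> {p, z} \<in> E")
    case True
    have "\<forall>r\<in>N. \<exists>q. q \<in> E \<and> (\<exists>p\<in>{u, v}. \<exists>z\<in>r. z \<noteq> w \<and> q = {p, z})"
    proof
      fix r assume "r \<in> N"
      with True obtain p z where "p \<in> {u, v}" "z \<in> r" "z \<noteq> w" "{p, z} \<in> E" by meson
      then show "\<exists>q. q \<in> E \<and> (\<exists>p\<in>{u, v}. \<exists>z\<in>r. z \<noteq> w \<and> q = {p, z})"
        by (intro exI[of _ "{p, z}"]) blast
    qed
    then obtain q where q: "\<And>r. r \<in> N \<Longrightarrow> q r \<in> E \<and> (\<exists>p\<in>{u, v}. \<exists>z\<in>r. z \<noteq> w \<and> q r = {p, z})"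
      by metis
    have NE: "r \<subseteq> S'" if "r \<in> N" for r
      using that by (auto simp: N_def isolated_def edges_in_def)
    have q_props: "e \<in> edges_in S \<and> e \<notin> edges_in S' \<and> e \<noteq> {u, w} \<and> e \<noteq> {v, w}" if e: "e \<in> q ` N" for e
    proof -
      obtain r where r: "r \<in> N" "e = q r" using e by blast
      then obtain p z where pz: "p \<in> {u, v}" "z \<in> r" "z \<noteq> w" "e = {p, z}" "e \<in> E" using q by metis
      have "z \<in> S - {u, v}" using NE[OF r(1)] pz by (auto simp: S'_def)
      then show ?thesis using pz d by (auto simp: edges_in_def S'_def doubleton_eq_iff dist2_def)
    qed
    have "feasible (N \<union> rows S') (\<lambda>e. of_bool (e \<in> q ` N) + bounded_usage s S' e)"
      using feasible_add_new_isolated[of S u v _ q] feas q unfolding S'_def N_def by blast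
    then have "feasible (T \<union> (N \<union> rows S')) (\<lambda>e. (if shift u v w e \<noteq> 0 then card T else 0)
        + (of_bool (e \<in> q ` N) + bounded_usage s S' e))"
    proof (rule feasible_add_direction[rotated -1])
      show "finite T" "finite (N \<union> rows S')" by (auto simp: T_def N_def)
      have sub: "N \<union> rows S' \<subseteq> edges_in S'" by (auto simp: N_def rows_def isolated_def)
      show "T \<inter> (N \<union> rows S') = {}"
        using sub by (auto simp: T_def edges_in_def S'_def)
      show "effect (shift u v w) i \<noteq> 0" if "i \<in> T" for i
        using that d' by (subst effect_shift_eq_0_iff) (auto simp: T_def edges_in_def)
      show "effect (shift u v w) i = 0" if "i \<in> N \<union> rows S'" for i
        using that sub d' by (subst effect_shift_eq_0_iff) (auto simp: edges_in_def S'_def)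
    qed
    moreover have "card T \<le> s"
    proof -
      have "T = {e \<in> edges_in S. u \<in> e} \<union> {e \<in> edges_in S. v \<in> e}" by (auto simp: T_def)
      then have "card T \<le> deg S u + deg S v" by (simp add: deg_def card_Un_le)
      then show ?thesis using deg by simp
    qed
    moreover have "edges_in S' \<subseteq> edges_in S" "{u, w} \<notin> edges_in S'" "{v, w} \<notin> edges_in S'"
      by (auto simp: edges_in_def S'_def)
    moreover have "(if shift u v w e \<noteq> 0 then k else 0) + (of_bool (e \<in> q ` N) + bounded_usage s S' e)
        \<le> bounded_usage s S e" if "k \<le> s" for k e
      using that q_props[of e] s d' calculation(3-)
      by (auto simp: shift_def single_def bounded_usage_def)
    ultimately show ?thesis unfolding rows by (blast intro: feasible_mono)
  next
    case False
    then obtain r where r: "r \<in> N" and no: "\<And>p z. \<lbrakk>p \<in> {u, v}; z \<in> r; {p, z} \<in> E\<rbrakk> \<Longrightarrow> z = w"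
      by blast
    obtain p z where pz: "p \<in> {u, v}" "z \<in> r" "{p, z} \<in> edges_in S"
      by (rule new_isolated_edge[OF r[unfolded N_def S'_def]])
    then have wr: "w \<in> r" using no by (auto simp: edges_in_def)
    have r': "r \<in> E" "r \<subseteq> S'" "r \<in> isolated S'" "r \<in> edges_in S"
      using r by (auto simp: N_def isolated_def edges_in_def S'_def)
    obtain b where b: "b \<noteq> w" "r = {w, b}" using edge_other_end[OF r'(1) wr] by blast
    have bS: "b \<in> S" "b \<noteq> u" "b \<noteq> v" using b r' by (auto simp: S'_def)
    have nadj: "{u, b} \<notin> E" "{v, b} \<notin> E" using no[of _ b] b by auto
    have bw: "{b, w} \<in> E" using b r' by (simp add: insert_commute)
    \<comment> \<open>Edges at \<open>b\<close> avoid \<open>u\<close> and \<open>v\<close>, so they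
      survive the removal and coincide with the isolated edge \<open>r\<close>.\<close>
    have "{e \<in> edges_in S. b \<in> e} = {r}"
    proof -
      have "e = r" if e: "e \<in> edges_in S" "b \<in> e" for e
      proof -
        have "e \<in> E" using e(1) by (simp add: edges_in_def)
        then obtain c where c: "e = {b, c}" using edge_other_end[OF _ e(2)] by blast
        have "c \<noteq> u" "c \<noteq> v" using nadj e c by (auto simp: edges_in_def insert_commute)
        then have "e \<in> edges_in S'" using e c bS by (auto simp: edges_in_def S'_def)
        then show ?thesis using isolated_eqI[OF r'(3)] b e by blast
      qed
      moreover have "b \<in> r" using b by simp
      ultimately show ?thesis using r'(4) by blast
    qed
    then have "deg S b = 1" by (simp add: deg_def)
    \<comment> \<open>Comparing the minimal degree sum with those of \<open>(u, b)\<close> and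
      \<open>(b, v)\<close> bounds the degrees of \<open>v\<close> and \<open>u\<close> by that of
      the leaf \<open>b\<close>.\<close>
    moreover have "dist2 S u b w" "dist2 S b v w"
      using d bS nadj bw by (auto simp: dist2_def insert_commute)
    ultimately have "deg S v \<le> 1" "deg S u \<le> 1" using min by fastforce+
    then have "e = {u, w}" if "e \<in> edges_in S" "u \<in> e" for e
      using that d'(1) by (auto simp: deg_def card_le_Suc0_iff_eq)
    moreover have "e = {v, w}" if "e \<in> edges_in S" "v \<in> e" for e
      using that d'(2) \<open>deg S v \<le> 1\<close> by (auto simp: deg_def card_le_Suc0_iff_eq)
    ultimately show ?thesis
      using feasible_star[OF d s] r'(3) wr feas unfolding S'_def by blast
  qed
qed

text \<open>The edge \<open>{x, w0}\<close> serves a new isolated edge, if there is one, so the shift along \<open>w0\<close> is used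
  only once. The slots \<open>{x, y}\<close> and \<open>{x, w0}\<close> carry the direction \<open>{x, y}\<close> instead of a shift.\<close>

lemma feasible_clique_step:
  fixes S x y
  defines "S' \<equiv> S - {x, y}"
  assumes tri: "x \<in> S" "y \<in> S" "z \<in> S" "{x, y} \<in> E" "{x, z} \<in> E" "{y, z} \<in> E" and s: "2 \<le> s"
    and trans: "\<And>u v w. \<not> dist2 S u v w"
    and feas: "feasible (rows S') (bounded_usage s S')"
  shows "feasible (rows S) (bounded_usage s S)"
proof -
  \<comment> \<open>Without pairs at distance 2, distinct neighbours of a vertex are adjacent, so
    \<open>U\<close> is also the set of neighbours of \<open>y\<close> in \<open>S'\<close>.\<close>
  define U where "U = {w \<in> S'. {x, w} \<in> E}"
  define X where "X = (\<lambda>w. {x, w}) ` U"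
  define Y where "Y = (\<lambda>w. {y, w}) ` U"
  define T where "T = insert {x, y} (X \<union> Y)"
  define N where "N = isolated S' - isolated S"
  have tr: "{u, v} \<in> E" if "{u, w} \<in> E" "{v, w} \<in> E" "u \<noteq> v" "u \<in> S" "v \<in> S" "w \<in> S" for u v w
    using trans[of u v w] that by (auto simp: dist2_def)
  have neq: "x \<noteq> y" "x \<noteq> z" "y \<noteq> z" using tri edge_neq by auto
  have yx: "{y, x} \<in> E" using tri by (simp add: insert_commute)
  have UE: "{x, w} \<in> E" "w \<in> S" "w \<noteq> x" "w \<noteq> y" "{y, w} \<in> E" if "w \<in> U" for w
  proof -
    show *: "{x, w} \<in> E" "w \<in> S" "w \<noteq> x" "w \<noteq> y" using that by (auto simp: U_def S'_def)
    then have "{w, x} \<in> E" by (simp add: insert_commute)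
    then show "{y, w} \<in> E" using tr[of y x w] yx tri * by metis
  qed
  have U_y: "w \<in> U" if "{y, w} \<in> E" "w \<in> S'" for w
  proof -
    have "w \<in> S" "w \<noteq> x" using that by (auto simp: S'_def)
    moreover have "{w, y} \<in> E" using that by (simp add: insert_commute)
    ultimately have "{x, w} \<in> E" using tr[of x y w] tri by metis
    then show ?thesis using that by (simp add: U_def)
  qed
  have "z \<in> U" using tri neq by (auto simp: U_def S'_def)
  have finX: "finite X" "finite Y" and TE: "T \<subseteq> edges_in S"
    using finE tri UE unfolding X_def Y_def T_def
    by (auto intro: finite_subset[OF _ finE] simp: edges_in_def)
  have finT: "finite T" using finX by (simp add: T_def)
  have T_eq: "{e \<in> edges_in S. x \<in> e \<or> y \<in> e} = T"
  proof
    show "T \<subseteq> {e \<in> edges_in S. x \<in> e \<or> y \<in> e}" using TE by (auto simp: T_def X_def Y_def)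
    show "{e \<in> edges_in S. x \<in> e \<or> y \<in> e} \<subseteq> T"
    proof clarify
      fix e assume e: "e \<in> edges_in S" "x \<in> e \<or> y \<in> e"
      then obtain p where p: "p \<in> {x, y}" "p \<in> e" by blast
      have "e \<in> E" using e(1) by (simp add: edges_in_def)
      then obtain c where pc: "p \<in> {x, y}" "e = {p, c}" "c \<noteq> p"
        using edge_other_end[OF _ p(2)] p(1) by blast
      show "e \<in> T"
      proof (cases "c \<in> {x, y}")
        case True
        then show ?thesis using pc by (auto simp: T_def insert_commute)
      next
        case False
        then have "c \<in> U" using pc e U_y by (auto simp: edges_in_def U_def S'_def)
        then show ?thesis using pc by (auto simp: T_def X_def Y_def)
      qed
    qed
  qed
  have xz: "{x, z} \<in> edges_in S" and yz: "{y, z} \<in> edges_in S" and xy: "{x, y} \<in> edges_in S"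
    using tri by (auto simp: edges_in_def)
  have pairs_neq: "{x, z} \<noteq> {y, z}" "{x, z} \<noteq> {x, y}" "{x, y} \<noteq> {y, z}"
    using neq by (auto simp: doubleton_eq_iff)
  have not_iso: "e \<notin> isolated S" if "e \<in> edges_in S" "x \<in> e \<or> y \<in> e" for e
    using that not_isolatedI[OF that(1) xz, of x] not_isolatedI[OF that(1) yz, of y]
      not_isolatedI[OF that(1) xy, of x] not_isolatedI[OF that(1) xy, of y] pairs_neq by auto
  have rows: "rows S = T \<union> (N \<union> rows S')"
    unfolding S'_def N_def T_eq[symmetric] by (rule rows_remove_two) (rule not_iso)
  have sub: "N \<union> rows S' \<subseteq> edges_in S'" by (auto simp: N_def rows_def isolated_def)
  have N_sub_U: "r \<subseteq> U" if r: "r \<in> N" for r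
  proof -
    obtain p t where pt: "p \<in> {x, y}" "t \<in> r" "{p, t} \<in> edges_in S"
      by (rule new_isolated_edge[OF r[unfolded N_def S'_def]])
    have rE: "r \<in> E" "r \<subseteq> S'" using r sub by (auto simp: edges_in_def)
    have tU: "t \<in> U" using pt rE U_y by (auto simp: U_def edges_in_def)
    obtain t' where t': "r = {t, t'}" "t' \<noteq> t" using edge_other_end[OF rE(1) pt(2)] by blast
    then have "{t', t} \<in> E" "t' \<in> S" "x \<noteq> t'"
      using rE by (auto simp: S'_def insert_commute)
    then have "{x, t'} \<in> E"
      using tr[of x t t'] UE[OF tU] tri by blast
    then show ?thesis using t' tU rE by (auto simp: U_def)
  qed
  \<comment> \<open>Vertices of \<open>U\<close> are pairwise adjacent via \<open>x\<close>, so two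
    distinct new isolated edges would be joined by an edge that survives the removal.\<close>
  have N_unique: "r = r'" if "r \<in> N" "r' \<in> N" for r r'
  proof -
    have rE: "r \<in> E" "r' \<in> E" "r' \<subseteq> S'" "r \<in> isolated S'" "r' \<in> isolated S'" "r \<subseteq> S'"
      using that sub by (auto simp: edges_in_def N_def)
    then obtain a a' where a: "a \<in> r" "a' \<in> r'" using ends by blast
    show ?thesis
    proof (cases "a = a'")
      case True
      then show ?thesis using isolated_eqI[of r' S' r a] rE a by (auto simp: isolated_def)
    next
      case False
      have "a \<in> U" "a' \<in> U" using N_sub_U that a by auto
      moreover from this have "{a, x} \<in> E" "{a', x} \<in> E"
        using UE(1) by (simp_all add: insert_commute)
      ultimately have "{a, a'} \<in> E"
        using tr[of a x a'] False UE(2) tri(1) by blast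
      then have "{a, a'} \<in> edges_in S'"
        using a rE by (auto simp: edges_in_def)
      then show ?thesis
        using isolated_eqI[of r S' "{a, a'}" a] isolated_eqI[of r' S' "{a, a'}" a'] rE a by auto
    qed
  qed
  obtain w0 where w0: "w0 \<in> U" and w0N: "\<And>r. r \<in> N \<Longrightarrow> w0 \<in> r"
  proof (cases "N = {}")
    case True
    then show ?thesis using that[OF \<open>z \<in> U\<close>] by auto
  next
    case False
    then obtain r where r: "r \<in> N" by auto
    then have "r \<in> E" using sub by (auto simp: edges_in_def)
    then obtain a where "a \<in> r" using ends by blast
    then show ?thesis using that[of a] N_sub_U[OF r] N_unique[OF r] by blast
  qed
  define q where "q r = {x, w0}" for r :: "'a set"
  have "feasible (N \<union> rows S') (\<lambda>e. of_bool (e \<in> q ` N) + bounded_usage s S' e)"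
    using feasible_add_new_isolated[of S x y "bounded_usage s S'" q] feas UE(1)[OF w0] w0N
    unfolding S'_def N_def q_def by blast
  then have feas': "feasible (N \<union> rows S') (\<lambda>e. of_bool (e = {x, w0}) + bounded_usage s S' e)"
    by (rule feasible_mono) (auto simp: q_def)
  \<comment> \<open>The end of \<open>j\<close> outside \<open>{x, y}\<close>; the value at
    \<open>{x, y}\<close> itself is unspecified, and \<open>d\<close> does not consult it
    there.\<close>
  define \<omega> where "\<omega> j = the_elem (j - {x, y})" for j :: "'a set"
  have \<omega>: "\<omega> {x, w} = w" "\<omega> {y, w} = w" if "w \<in> U" for w
    using UE[OF that] by (auto simp: \<omega>_def insert_Diff_if)
  define d where "d j = (if j = {x, y} \<or> j = {x, w0} then single {x, y} else shift x y (\<omega> j))" for j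
  \<comment> \<open>The effect of a shift does not depend on its middle vertex, so \<open>z\<close>
    stands for every vertex of \<open>U\<close>.\<close>
  define b where "b i = effect (shift x y z) i" for i
  have b: "effect (shift x y w) i = b i" if "w \<in> U" for w i
    using UE[OF that] tri neq by (simp add: b_def effect_shift)
  have \<omega>U: "\<omega> j \<in> U" if "j \<in> T" "j \<noteq> {x, y}" for j
    using that \<omega> by (auto simp: T_def X_def Y_def)
  define g where "g i = inc {x, y} i" for i
  have g: "effect (single {x, y}) i = g i" for i
    using tri by (simp add: g_def effect_single)
  have per: "permanent T (\<lambda>i j. effect (d j) i) \<noteq> 0"
  proof -
    have "permanent T (\<lambda>i j. effect (d j) i)
        = permanent T (\<lambda>i j. if j = {x, y} \<or> j = {x, w0} then g i else b i)"
      by (rule permanent_cong) (use \<omega>U in \<open>auto simp: d_def g b\<close>)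
    also have "\<dots> \<noteq> 0"
    proof (rule permanent_two_columns_nonzero[OF finT])
      show "{x, y} \<in> T" "{x, w0} \<in> T" "{x, z} \<in> T"
        using w0 \<open>z \<in> U\<close> by (auto simp: T_def X_def)
      show "{x, y} \<noteq> {x, w0}" using UE[OF w0] neq by (auto simp: doubleton_eq_iff)
      show "b i \<noteq> 0" if "i \<in> T" for i
        using that T_eq tri neq unfolding b_def
        by (subst effect_shift_eq_0_iff) (auto simp: edges_in_def)
      show "g {x, z} \<noteq> 0"
        using tri neq by (simp add: g_def inc_eq_0_iff)
      have bw: "b i = of_bool (src i = x) - of_bool (src i = y) - of_bool (tgt i = x) + of_bool (tgt i = y)" for i
        unfolding b_def by (rule effect_shift) (use tri neq in auto)
      \<comment> \<open>The shift raises the colour of \<open>x\<close> and lowers that of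
        \<open>y\<close>, while the weight of \<open>{x, y}\<close> raises both. The quotients over
        \<open>X\<close> and \<open>Y\<close>, both indexed by \<open>U\<close>, therefore
        cancel.\<close>
      have gX: "g {x, w} / b {x, w} = 1" and gY: "g {y, w} / b {y, w} = - 1" if "w \<in> U" for w
        using pair_ends[OF UE(1)[OF that]] pair_ends[OF UE(5)[OF that]] UE[OF that] neq
        by (auto simp: g_def inc_def bw)
      have "g {x, y} = 0" using tri by (simp add: g_def inc_eq_0_iff)
      have inj: "inj_on (\<lambda>w. {p, w}) U" for p
        by (auto simp: inj_on_def doubleton_eq_iff)
      have disj: "X \<inter> Y = {}" "{x, y} \<notin> X \<union> Y"
        using neq by (auto simp: X_def Y_def U_def S'_def doubleton_eq_iff)
      have "(\<Sum>i\<in>X. g i / b i) = (\<Sum>w\<in>U. 1)" "(\<Sum>i\<in>Y. g i / b i) = (\<Sum>w\<in>U. - 1)"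
        unfolding X_def Y_def sum.reindex[OF inj] o_def
        by (intro sum.cong refl gX gY; assumption)+
      then show "(\<Sum>i\<in>T. g i / b i) = 0"
        using disj finX \<open>g {x, y} = 0\<close> by (simp add: T_def sum.union_disjoint)
    qed
    finally show ?thesis .
  qed
  have "feasible (T \<union> (N \<union> rows S'))
      (\<lambda>e. card {j \<in> T. d j e \<noteq> 0} + (of_bool (e = {x, w0}) + bounded_usage s S' e))"
  proof (rule feasible_add[OF finT _ _ per _ feas'])
    show "finite (N \<union> rows S')" by (simp add: N_def)
    show "T \<inter> (N \<union> rows S') = {}"
      using sub T_eq by (auto simp: edges_in_def S'_def)
    show "effect (d j) i = 0" if i: "i \<in> N \<union> rows S'" and j: "j \<in> T" for i j
    proof -
      have iE: "i \<in> E" "x \<notin> i" "y \<notin> i" using i sub by (auto simp: edges_in_def S'_def)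
      have "b i = 0" unfolding b_def using iE tri neq by (subst effect_shift_eq_0_iff) auto
      moreover have "g i = 0" unfolding g_def using iE by (intro inc_disjoint) auto
      ultimately show ?thesis using j \<omega>U by (auto simp: d_def g b)
    qed
  qed
  moreover have "card {j \<in> T. d j e \<noteq> 0} + (of_bool (e = {x, w0}) + bounded_usage s S' e)
      \<le> bounded_usage s S e" for e
  proof -
    have shift_nz: "e = {x, \<omega> j} \<or> e = {y, \<omega> j}" if "shift x y (\<omega> j) e \<noteq> 0" for j
      using that by (cases "e = {x, \<omega> j}"; cases "e = {y, \<omega> j}") (simp_all add: shift_def single_def)
    have sing_nz: "e = {x, y}" if "single {x, y} e \<noteq> 0"
      using that by (auto simp: single_def split: if_splits)
    have T_\<omega>: "j = {x, \<omega> j} \<or> j = {y, \<omega> j}" if "j \<in> T" "j \<noteq> {x, y}" for j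
      using that \<omega> by (auto simp: T_def X_def Y_def)
    have card2: "card A \<le> 2" if "A \<subseteq> {a, b}" for A and a b :: "'a set"
      using card_mono[OF _ that] by (simp add: card_insert_if split: if_splits)
    \<comment> \<open>The charges are at most 2 for \<open>{x, y}\<close>, one shift plus one for a
      new isolated edge on \<open>{x, w0}\<close>, and two shifts on any other edge of
      \<open>T\<close>.\<close>
    consider "e = {x, y}" | "e = {x, w0}" | "e \<in> T" "e \<noteq> {x, y}" "e \<noteq> {x, w0}" | "e \<notin> T" by blast
    then show ?thesis
    proof cases
      case 1
      have "{j \<in> T. d j e \<noteq> 0} \<subseteq> {{x, y}, {x, w0}}"
        using 1 shift_nz \<omega>U UE neq by (auto simp: d_def doubleton_eq_iff)
      then have "card {j \<in> T. d j e \<noteq> 0} \<le> 2"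
        by (rule card2)
      moreover have "e \<noteq> {x, w0}" using 1 UE[OF w0] by (auto simp: doubleton_eq_iff)
      moreover have "e \<notin> edges_in S'" using 1 by (auto simp: edges_in_def S'_def)
      ultimately show ?thesis using 1 s xy by (simp add: bounded_usage_def)
    next
      case 2
      have "{j \<in> T. d j e \<noteq> 0} \<subseteq> {{y, w0}}"
      proof
        fix j assume "j \<in> {j \<in> T. d j e \<noteq> 0}"
        then have j: "j \<in> T" "d j e \<noteq> 0" by auto
        have "e \<noteq> {x, y}" using 2 UE[OF w0] by (auto simp: doubleton_eq_iff)
        then have ne: "j \<noteq> {x, y}" "j \<noteq> {x, w0}" "shift x y (\<omega> j) e \<noteq> 0"
          using j sing_nz by (auto simp: d_def split: if_splits)
        then have "\<omega> j = w0"
          using shift_nz[OF ne(3)] 2 \<omega>U[OF j(1) ne(1)] UE w0 neq by (auto simp: doubleton_eq_iff)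
        then show "j \<in> {{y, w0}}" using T_\<omega>[OF j(1) ne(1)] ne by simp
      qed
      then have "card {j \<in> T. d j e \<noteq> 0} \<le> 1"
        using card_mono[of "{{y, w0}}"] by fastforce
      moreover have "e \<in> edges_in S" "e \<notin> edges_in S'"
        using 2 UE[OF w0] tri by (auto simp: edges_in_def S'_def)
      ultimately show ?thesis using 2 s by (simp add: bounded_usage_def)
    next
      case 3
      have "{j \<in> T. d j e \<noteq> 0} \<subseteq> {{x, \<omega> e}, {y, \<omega> e}}"
      proof
        fix j assume "j \<in> {j \<in> T. d j e \<noteq> 0}"
        then have j: "j \<in> T" "d j e \<noteq> 0" by auto
        have ne: "j \<noteq> {x, y}" "shift x y (\<omega> j) e \<noteq> 0"
          using j 3 sing_nz by (auto simp: d_def split: if_splits)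
        then have "\<omega> j = \<omega> e"
          using shift_nz[OF ne(2)] \<omega> \<omega>U[OF j(1) ne(1)] by metis
        then show "j \<in> {{x, \<omega> e}, {y, \<omega> e}}" using T_\<omega>[OF j(1) ne(1)] by simp
      qed
      then have "card {j \<in> T. d j e \<noteq> 0} \<le> 2"
        by (rule card2)
      moreover have "e \<in> edges_in S" "e \<notin> edges_in S'"
        using 3 TE T_eq by (auto simp: edges_in_def S'_def)
      ultimately show ?thesis using 3 s by (simp add: bounded_usage_def)
    next
      case 4
      have "d j e = 0" if "j \<in> T" for j
      proof (rule ccontr)
        assume "d j e \<noteq> 0"
        moreover have "e \<noteq> {x, y}" using 4 by (auto simp: T_def)
        ultimately have "j \<noteq> {x, y}" "shift x y (\<omega> j) e \<noteq> 0"
          using sing_nz by (auto simp: d_def split: if_splits)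
        then show False using shift_nz[of j] \<omega>U[of j] that 4 by (auto simp: T_def X_def Y_def)
      qed
      then have "{j \<in> T. d j e \<noteq> 0} = {}" by auto
      then have "card {j \<in> T. d j e \<noteq> 0} = 0" by (metis card.empty)
      moreover have "e \<noteq> {x, w0}" using 4 w0 by (auto simp: T_def X_def)
      moreover have "bounded_usage s S' e \<le> bounded_usage s S e"
        by (auto simp: bounded_usage_def edges_in_def S'_def)
      ultimately show ?thesis by simp
    qed
  qed
  ultimately show ?thesis unfolding rows by (rule feasible_mono)
qed

text \<open>Induction on the vertex set: a pair at distance 2 with least degree sum is removed if
  there is one. Otherwise a row and another edge meeting it span a triangle, and the clique step
  applies. The bound covers all subsets because the induction passes to them.\<close>

lemma feasible_rows:
  assumes "finite S" and s: "2 \<le> s"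
    and bound: "\<And>S' u v w. \<lbrakk>S' \<subseteq> S; dist2 S' u v w\<rbrakk> \<Longrightarrow>
      \<exists>u v w. dist2 S' u v w \<and> deg S' u + deg S' v \<le> s"
  shows "feasible (rows S) (bounded_usage s S)"
  using assms(1,3)
proof (induction S rule: finite_psubset_induct)
  case (psubset S)
  have IH: "feasible (rows (S - {u, v})) (bounded_usage s (S - {u, v}))" if "u \<in> S" for u v
  proof (rule psubset.IH)
    show "S - {u, v} \<subset> S" using that by auto
    fix S' u' v' w' assume "S' \<subseteq> S - {u, v}" and d: "dist2 S' u' v' w'"
    then have "S' \<subseteq> S" by blast
    then show "\<exists>u v w. dist2 S' u v w \<and> deg S' u + deg S' v \<le> s"
      using d by (rule psubset.prems)
  qed
  show ?case
  proof (cases "\<exists>u v w. dist2 S u v w")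
    case True
    define P where "P = (\<lambda>(u, v). \<exists>w. dist2 S u v w)"
    have "\<exists>p. P p" using True by (auto simp: P_def)
    then obtain p where p: "P p"
      and min: "\<And>p'. P p' \<Longrightarrow> (\<lambda>(u, v). deg S u + deg S v) p \<le> (\<lambda>(u, v). deg S u + deg S v) p'"
      using ex_has_least_nat[of P _ "\<lambda>(u, v). deg S u + deg S v"] by metis
    obtain u v where uv: "p = (u, v)" by (cases p)
    have min: "deg S u + deg S v \<le> deg S u' + deg S v'" if "dist2 S u' v' w'" for u' v' w'
      using min[of "(u', v')"] that uv by (auto simp: P_def)
    obtain w where d: "dist2 S u v w" using p uv by (auto simp: P_def)
    obtain u' v' w' where "dist2 S u' v' w'" "deg S u' + deg S v' \<le> s"
      using psubset.prems[OF order_refl d] by blast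
    then have "deg S u + deg S v \<le> s" using min order_trans by blast
    then show ?thesis
      using feasible_dist2_step[OF d s] min IH d by (auto simp: dist2_def)
  next
    case False
    show ?thesis
    proof (cases "rows S = {}")
      case True
      then show ?thesis by (simp add: feasible_empty)
    next
      case nonempty: False
      then obtain r f a where r: "r \<in> edges_in S" and f: "f \<in> edges_in S" "f \<noteq> r" and a: "a \<in> f" "a \<in> r"
        by (auto simp: rows_def isolated_def)
      have "r \<in> E" "f \<in> E" using r f by (auto simp: edges_in_def)
      then obtain y z where yz: "r = {a, y}" "f = {a, z}"
        using edge_other_end a by metis
      have "y \<noteq> z" using f yz by auto
      have inS: "a \<in> S" "y \<in> S" "z \<in> S" using r f yz by (auto simp: edges_in_def)
      have "\<not> dist2 S y z a" using False by blast
      then have "{y, z} \<in> E"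
        using yz \<open>r \<in> E\<close> \<open>f \<in> E\<close> \<open>y \<noteq> z\<close> inS by (auto simp: dist2_def insert_commute)
      then show ?thesis
        using feasible_clique_step[of a S y z s] inS yz \<open>r \<in> E\<close> \<open>f \<in> E\<close> s False IH by blast
    qed
  qed
qed

end

section \<open>The bound on degree sums\<close>

text \<open>The right-hand side rules out walks of one or two vertices, and \<open>[u, w, v]\<close>
  is a walk of length 2.\<close>

lemma gdist_eq_2_iff:
  assumes "simple_graph H" "u \<in> verts H" "v \<in> verts H"
  shows "gdist H u v = 2 \<longleftrightarrow>
    u \<noteq> v \<and> {u, v} \<notin> edges H \<and> (\<exists>w\<in>verts H. {u, w} \<in> edges H \<and> {v, w} \<in> edges H)"
proof
  assume dist: "gdist H u v = 2"
  have le: "2 \<le> enat (length p - 1)" if "p \<in> walks H u v" for p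
    unfolding dist[symmetric] gdist_def using that by (rule INF_lower)
  have "walks H u v \<noteq> {}"
    using dist by (auto simp: gdist_def top_enat_def)
  \<comment> \<open>By well-ordering, the infimum of a nonempty set of extended naturals is
    attained.\<close>
  then have "gdist H u v \<in> (\<lambda>p. enat (length p - 1)) ` walks H u v"
    unfolding gdist_def Inf_enat_def by (auto intro: LeastI)
  then obtain p where p: "p \<in> walks H u v" "enat (length p - 1) = 2"
    using dist by auto
  then have "length p = Suc (Suc (Suc 0))" by (simp add: numeral_eq_enat)
  then obtain w where "p = [u, w, v]" "w \<in> verts H"
    using p(1) by (auto simp: walks_def length_Suc_conv)
  then have "{u, w} \<in> edges H" "{v, w} \<in> edges H"
    using p(1) by (auto simp: walks_def insert_commute)
  moreover have "u \<noteq> v"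
    using le[of "[u]"] assms(2) by (auto simp: walks_def numeral_eq_enat)
  moreover have "{u, v} \<notin> edges H"
    using le[of "[u, v]"] assms(2,3) by (auto simp: walks_def numeral_eq_enat)
  ultimately show "u \<noteq> v \<and> {u, v} \<notin> edges H \<and> (\<exists>w\<in>verts H. {u, w} \<in> edges H \<and> {v, w} \<in> edges H)"
    using \<open>w \<in> verts H\<close> by blast
next
  assume R: "u \<noteq> v \<and> {u, v} \<notin> edges H \<and> (\<exists>w\<in>verts H. {u, w} \<in> edges H \<and> {v, w} \<in> edges H)"
  then obtain w where w: "w \<in> verts H" "{u, w} \<in> edges H" "{v, w} \<in> edges H" by blast
  have "[u, w, v] \<in> walks H u v"
    using w assms by (simp add: walks_def insert_commute)
  then have "gdist H u v \<le> enat (length [u, w, v] - 1)"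
    unfolding gdist_def by (rule INF_lower)
  moreover have "2 \<le> gdist H u v"
    unfolding gdist_def
  proof (rule INF_greatest)
    fix p assume p: "p \<in> walks H u v"
    have "length p \<noteq> 0" "length p \<noteq> Suc 0" "length p \<noteq> Suc (Suc 0)"
      using p R by (auto simp: walks_def length_Suc_conv)
    then have "2 \<le> length p - 1" by linarith
    then show "2 \<le> enat (length p - 1)" by (simp add: numeral_eq_enat)
  qed
  ultimately show "gdist H u v = 2"
    by (intro antisym) (simp_all add: numeral_eq_enat numeral_2_eq_2)
qed

lemma simple_graph_induced:
  assumes "simple_graph G" "S \<subseteq> verts G"
  shows "simple_graph (induced_subgraph G S)"
  using assms finite_subset by (auto simp: simple_graph_def induced_subgraph_def)

lemma simple_graph_finite_edges:
  assumes "simple_graph G"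
  shows "finite (edges G)"
  by (rule finite_subset[of _ "Pow (verts G)"]) (use assms in \<open>auto simp: simple_graph_def\<close>)

section \<open>Degree sums in induced subgraphs, niceness, and the choice of weights\<close>

context oriented_graph
begin

lemma edges_in_induced: "edges G = E \<Longrightarrow> edges (induced_subgraph G S) = edges_in S"
  by (simp add: induced_subgraph_def edges_in_def)

lemma deg_pos:
  assumes "e \<in> edges_in S" "v \<in> e"
  shows "1 \<le> deg S v"
proof -
  have "{e \<in> edges_in S. v \<in> e} \<noteq> {}" using assms by blast
  then show ?thesis by (simp add: deg_def Suc_le_eq card_gt_0_iff)
qed

lemma dist2_pairs_induced:
  assumes "simple_graph G" "edges G = E" "S \<subseteq> verts G"
  shows "dist2_pairs (induced_subgraph G S) = {(u, v). \<exists>w. dist2 S u v w}"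
proof -
  have verts: "verts (induced_subgraph G S) = S" by (simp add: induced_subgraph_def)
  note simple = simple_graph_induced[OF assms(1,3)]
  show ?thesis
    unfolding dist2_pairs_def verts
    using gdist_eq_2_iff[OF simple, unfolded verts edges_in_induced[OF assms(2)]]
    by (auto simp: dist2_def edges_in_def)
qed

text \<open>The minimum is over a finite nonempty set of pairs; the pair attaining it is the one
  that the induction over vertex removals asks for.\<close>

lemma delta2_induced_attained:
  assumes "simple_graph G" "edges G = E" "S \<subseteq> verts G" "dist2 S u v w"
  shows "\<exists>u v w. dist2 S u v w \<and> deg S u + deg S v = delta2 (induced_subgraph G S)"
proof -
  define H where "H = induced_subgraph G S"
  have pairs: "dist2_pairs H = {(u, v). \<exists>w. dist2 S u v w}"
    unfolding H_def by (rule dist2_pairs_induced[OF assms(1-3)])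
  have "finite S" using assms(1,3) finite_subset by (auto simp: simple_graph_def)
  from this this have "finite (dist2_pairs H)"
    by (rule finite_subset[rotated, OF finite_cartesian_product]) (auto simp: pairs dist2_def)
  moreover have "dist2_pairs H \<noteq> {}" using assms(4) by (auto simp: pairs)
  ultimately have "delta2 H \<in> (\<lambda>(u, v). vdegree H u + vdegree H v) ` dist2_pairs H"
    unfolding delta2_def by (intro Min_in) auto
  moreover have "vdegree H v = deg S v" for v
    by (simp add: vdegree_def deg_def H_def edges_in_induced assms(2))
  ultimately obtain a b where "(a, b) \<in> dist2_pairs H" "deg S a + deg S b = delta2 H"
    by auto
  then show ?thesis unfolding H_def[symmetric] pairs by blast
qed

lemma delta2_le_partial2:
  assumes "simple_graph G" "edges G = E" "S \<subseteq> verts G" "dist2 S u v w"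
  shows "delta2 (induced_subgraph G S) \<le> partial2 G"
proof -
  have "induced_subgraph G S \<in> dist2_subgraphs G"
    using assms dist2_pairs_induced[OF assms(1-3)] by (auto simp: dist2_subgraphs_def)
  moreover have "finite (dist2_subgraphs G)"
    using assms(1) by (auto simp: dist2_subgraphs_def simple_graph_def)
  ultimately show ?thesis by (auto simp: partial2_def)
qed

text \<open>The removal steps may charge a weight twice. Under the convention, an edge forces
  maximum degree at least 1; otherwise both vertices of a pair at distance 2 have positive
  degree.\<close>

lemma partial2_ge_2:
  assumes "simple_graph G" "edges G = E" "E \<noteq> {}"
  shows "2 \<le> partial2 G"
proof (cases "dist2_subgraphs G = {}")
  case True
  obtain e where e: "e \<in> E" using assms(3) by blast
  then have "src e \<in> e" "e \<subseteq> verts G" using ends assms by (auto simp: simple_graph_def)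
  then have v: "src e \<in> verts G" by auto
  have "{e' \<in> E. src e \<in> e'} \<noteq> {}" using e \<open>src e \<in> e\<close> by blast
  then have "1 \<le> vdegree G (src e)"
    using finE by (simp add: vdegree_def assms(2) Suc_le_eq card_gt_0_iff)
  also have "\<dots> \<le> max_degree G"
    unfolding max_degree_def using v assms(1) by (intro Max_ge) (auto simp: simple_graph_def)
  finally show ?thesis using True by (simp add: partial2_def)
next
  case False
  then obtain S where S: "S \<subseteq> verts G" "dist2_pairs (induced_subgraph G S) \<noteq> {}"
    by (auto simp: dist2_subgraphs_def)
  then obtain u v w where d: "dist2 S u v w"
    using dist2_pairs_induced[OF assms(1,2)] by auto
  obtain u' v' w' where d': "dist2 S u' v' w'" "deg S u' + deg S v' = delta2 (induced_subgraph G S)"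
    using delta2_induced_attained[OF assms(1,2) S(1) d] by blast
  have "1 \<le> deg S u'" "1 \<le> deg S v'"
    using deg_pos dist2_edges_in(1,2)[OF d'(1)] by (meson insertI1)+
  then show ?thesis using d'(2) delta2_le_partial2[OF assms(1,2) S(1) d] by linarith
qed

text \<open>Here niceness enters: a walk starting on an isolated edge cannot leave it, so the edge
  would be a component isomorphic to \<open>complete_graph 2\<close>.\<close>

lemma isolated_verts_empty:
  assumes "simple_graph G" "edges G = E" "nice G"
  shows "isolated (verts G) = {}"
proof (rule ccontr)
  assume "isolated (verts G) \<noteq> {}"
  then obtain r where r: "r \<in> isolated (verts G)" by blast
  have edges_in_verts: "edges_in (verts G) = E"
    using assms by (auto simp: edges_in_def simple_graph_def)
  then have "r \<in> E" using r by (auto simp: isolated_def)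
  then obtain a b where ab: "r = {a, b}" "a \<noteq> b" using ends ends_neq by metis
  have inV: "a \<in> verts G" "b \<in> verts G"
    using \<open>r \<in> E\<close> ab assms by (auto simp: simple_graph_def)
  have stay: "set p \<subseteq> r"
    if "successively (\<lambda>x y. {x, y} \<in> E) p" "p \<noteq> []" "hd p \<in> r" for p
    using that
  proof (induction p rule: induct_list012)
    case (3 x y zs)
    then have "{x, y} = r"
      using isolated_eqI[OF r, of "{x, y}" x] edges_in_verts by simp
    then show ?case using 3 by auto
  qed auto
  have "{u. walks G a u \<noteq> {}} = r"
  proof
    show "{u. walks G a u \<noteq> {}} \<subseteq> r"
      using stay ab assms(2) by (fastforce simp: walks_def dest: last_in_set)
    have "[a] \<in> walks G a a" "[a, b] \<in> walks G a b"
      using inV ab \<open>r \<in> E\<close> assms(2) by (auto simp: walks_def)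
    then show "r \<subseteq> {u. walks G a u \<noteq> {}}" using ab by auto
  qed
  then have "induced_subgraph G r \<in> components G"
    unfolding components_def using inV by (intro image_eqI[of _ _ a]) auto
  moreover have "graph_isomorphic (induced_subgraph G r) (complete_graph 2)"
    unfolding graph_isomorphic_def
  proof (intro exI[of _ "\<lambda>z. if z = a then 0 else 1 :: nat"] conjI ballI)
    show "bij_betw (\<lambda>z. if z = a then 0 else 1) (verts (induced_subgraph G r)) (verts (complete_graph 2))"
      using ab by (auto simp: bij_betw_def inj_on_def induced_subgraph_def complete_graph_def)
    fix u v assume "u \<in> verts (induced_subgraph G r)" "v \<in> verts (induced_subgraph G r)"
    then have "u \<in> {a, b}" "v \<in> {a, b}" using ab by (auto simp: induced_subgraph_def)
    then show "{u, v} \<in> edges (induced_subgraph G r) \<longleftrightarrow>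
        {if u = a then 0 else 1, if v = a then 0 else 1} \<in> edges (complete_graph 2)"
      using ab \<open>r \<in> E\<close> assms(2) edge_neq[of a a] edge_neq[of b b]
      by (auto simp: induced_subgraph_def complete_graph_def insert_commute)
  qed
  ultimately show False using assms(3) by (auto simp: nice_def)
qed

lemma feasible_edges:
  assumes "simple_graph G" "edges G = E" "nice G"
  shows "feasible E (\<lambda>e. partial2 G)"
proof (cases "E = {}")
  \<comment> \<open>Without edges \<open>partial2 G\<close> is 0, below the value 2 that the removal
    steps require.\<close>
  case True
  then show ?thesis using feasible_empty by metis
next
  case False
  have "feasible (rows (verts G)) (bounded_usage (partial2 G) (verts G))"
  proof (rule feasible_rows)
    show "finite (verts G)" using assms(1) by (simp add: simple_graph_def)
    show "2 \<le> partial2 G" by (rule partial2_ge_2[OF assms(1,2) False])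
    fix S u v w assume S: "S \<subseteq> verts G" and d: "dist2 S u v w"
    show "\<exists>u v w. dist2 S u v w \<and> deg S u + deg S v \<le> partial2 G"
      using delta2_induced_attained[OF assms(1,2) S d] delta2_le_partial2[OF assms(1,2) S d] by metis
  qed
  moreover have "rows (verts G) = E"
    using isolated_verts_empty[OF assms] assms(1,2)
    by (auto simp: rows_def edges_in_def simple_graph_def)
  ultimately have "feasible E (bounded_usage (partial2 G) (verts G))" by simp
  then show ?thesis by (rule feasible_mono) (simp add: bounded_usage_def)
qed

text \<open>The fixed vertex weights become the constant terms of the affine forms whose linear
  parts have the coefficients \<open>inc e i\<close>.\<close>

lemma proper_weights_exist:
  fixes wv :: "'a \<Rightarrow> real"
  assumes feas: "feasible E (\<lambda>e. s)"
    and lists: "\<And>e. e \<in> E \<Longrightarrow> finite (L e) \<and> card (L e) = Suc s"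
  shows "\<exists>we. (\<forall>e\<in>E. we e \<in> L e) \<and> (\<forall>u v. {u, v} \<in> E \<longrightarrow>
    wv u + (\<Sum>e | e \<in> E \<and> u \<in> e. we e) \<noteq> wv v + (\<Sum>e | e \<in> E \<and> v \<in> e. we e))"
proof -
  obtain d where per: "permanent E (\<lambda>i j. \<Sum>e\<in>E. d j e * inc e i) \<noteq> 0"
    and usage: "\<And>e. card {j \<in> E. d j e \<noteq> 0} \<le> s"
    using feas unfolding feasible_def effect_def by blast
  have "\<exists>x. (\<forall>e\<in>E. x e \<in> L e) \<and>
      (\<forall>i\<in>E. (\<Sum>e\<in>E. inc e i * x e) + (wv (src i) - wv (tgt i)) \<noteq> 0)"
    by (rule nonvanishing_of_permanent[OF finE finE _ _ per]) (use lists usage in auto)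
  then obtain x where x: "\<forall>e\<in>E. x e \<in> L e"
    and nz: "\<forall>i\<in>E. (\<Sum>e\<in>E. inc e i * x e) + (wv (src i) - wv (tgt i)) \<noteq> 0"
    by blast
  have diff: "(\<Sum>e\<in>E. inc e i * x e)
      = (\<Sum>e | e \<in> E \<and> src i \<in> e. x e) - (\<Sum>e | e \<in> E \<and> tgt i \<in> e. x e)" for i
  proof -
    have "(\<Sum>e | e \<in> E \<and> z \<in> e. x e) = (\<Sum>e\<in>E. of_bool (z \<in> e) * x e)" for z
      unfolding sum.inter_filter[OF finE] by (intro sum.cong) auto
    then show ?thesis by (simp add: inc_def left_diff_distrib sum_subtractf)
  qed
  have "wv u + (\<Sum>e | e \<in> E \<and> u \<in> e. x e) \<noteq> wv v + (\<Sum>e | e \<in> E \<and> v \<in> e. x e)"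
    if e: "{u, v} \<in> E" for u v
    using nz[rule_format, OF e] pair_ends[OF e] unfolding diff by auto
  then show ?thesis using x by blast
qed

end

theorem corollary4p2:
  fixes G :: "'a ugraph"
  assumes "simple_graph G" and "nice G"
  shows "weight_choosable G 1 (partial2 G + 1)"
proof -
  have "\<forall>e\<in>edges G. \<exists>a b. e = {a, b} \<and> a \<noteq> b"
    using assms(1) by (auto simp: simple_graph_def card_2_iff)
  then obtain src tgt where "\<And>e. e \<in> edges G \<Longrightarrow> e = {src e, tgt e} \<and> src e \<noteq> tgt e"
    by metis
  then interpret oriented_graph "edges G" src tgt
    by unfold_locales (use assms(1) simple_graph_finite_edges in blast)+
  show ?thesis
    unfolding weight_choosable_def
  proof (intro allI impI, elim conjE)
    fix Lv :: "'a \<Rightarrow> real set" and Le :: "'a set \<Rightarrow> real set"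
    assume Lv: "\<forall>v\<in>verts G. finite (Lv v) \<and> card (Lv v) = 1"
      and Le: "\<forall>e\<in>edges G. finite (Le e) \<and> card (Le e) = partial2 G + 1"
    \<comment> \<open>The vertex lists are singletons, so the vertex weights are settled before any
      edge weight is chosen.\<close>
    have "\<forall>v\<in>verts G. \<exists>x. x \<in> Lv v" using Lv by (auto simp: card_1_singleton_iff)
    then obtain wv where wv: "\<forall>v\<in>verts G. wv v \<in> Lv v" by metis
    have "\<exists>we. (\<forall>e\<in>edges G. we e \<in> Le e) \<and> (\<forall>u v. {u, v} \<in> edges G \<longrightarrow>
        wv u + (\<Sum>e | e \<in> edges G \<and> u \<in> e. we e) \<noteq> wv v + (\<Sum>e | e \<in> edges G \<and> v \<in> e. we e))"
      by (rule proper_weights_exist[OF feasible_edges[OF assms(1) refl assms(2)]]) (use Le in simp)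
    then obtain we where "\<forall>e\<in>edges G. we e \<in> Le e"
      and "\<forall>u v. {u, v} \<in> edges G \<longrightarrow> wv u + (\<Sum>e | e \<in> edges G \<and> u \<in> e. we e)
        \<noteq> wv v + (\<Sum>e | e \<in> edges G \<and> v \<in> e. we e)"
      by blast
    then show "\<exists>wv we. (\<forall>v\<in>verts G. wv v \<in> Lv v) \<and> (\<forall>e\<in>edges G. we e \<in> Le e) \<and>
        (\<forall>u\<in>verts G. \<forall>v\<in>verts G. {u, v} \<in> edges G \<longrightarrow>
          wv u + (\<Sum>e | e \<in> edges G \<and> u \<in> e. we e) \<noteq> wv v + (\<Sum>e | e \<in> edges G \<and> v \<in> e. we e))"
      using wv by blast
  qed
qed

end
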